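(* Let $A\in\mathbb{C}^{N\times N}$ with $\|A-I\|<1$, let $b\in\mathbb{C}^N$ with $\log(A)b\neq 0$, let $M$ be a positive integer, and let $\boldsymbol{x}\in\mathbb{C}^{NM}$ be the solution of $\boldsymbol{A}\boldsymbol{x}=\boldsymbol{b}$. Assume that the linear-system solver in Step 1 of the algorithm outputs a state $|\tilde{\boldsymbol{x}}\rangle$ such that $\||\boldsymbol{x}\rangle-|\tilde{\boldsymbol{x}}\rangle\|\le\epsilon'$, where $0<\epsilon'<\frac12$. Then the actual output state $|\tilde f\rangle$ of the algorithm (assumed well defined, i.e. $\tilde{\boldsymbol{f}}\ne 0$) satisfies $$\left\||f\rangle-|\tilde f\rangle\right\|\le\frac{2}{K}\left(\epsilon_{M,A}+\sqrt{M}\,\delta_M\,\epsilon'\right),$$ where $K=\|\log(A)|b\rangle\|\,(1-\|A-I\|)$, $\ \epsilon_{M,A}=\left|r_M(-\|A-I\|)-\log(1-\|A-I\|)\right|$, and $\delta_M=\|A-I\|\left(\sum_{j=1}^M|\omega_j|^2\right)^{1/2}$.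
   Context: $\|\cdot\|$ is the Euclidean norm of vectors and the induced operator 2-norm of matrices; $\log(A)$ is the principal logarithm, and $f(A)=\log(A)$. Let $t_j,s_j$ ($1\le j\le M$) be the nodes and weights of $M$-point Gauss-Legendre quadrature on $[-1,1]$, and set $\tau_j=\frac12t_j+\frac12$, $\omega_j=\frac12 s_j$. The rational function $r_M(x)$ is the $(M,M)$ Padé approximant to $\log(1+x)$. The matrix $\boldsymbol{A}\in\mathbb{C}^{NM\times NM}$ is block diagonal with diagonal blocks $\tau_j(A-I)+I$, $j=1,\dots,M$; $\boldsymbol{b}=(b,\dots,b)^T\in\mathbb{C}^{NM}$ ($M$ copies of $b$). The solution of $\boldsymbol{A}\boldsymbol{x}=\boldsymbol{b}$ is $\boldsymbol{x}=(x^{(1)},\dots,x^{(M)})^T$ with $x^{(j)}=[\tau_j(A-I)+I]^{-1}b\in\mathbb{C}^N$. For a nonzero vector $v$, $|v\rangle=v/\|v\|$ denotes the corresponding state; in particular $|b\rangle=b/\|b\|$ and $|\boldsymbol{x}\rangle=\boldsymbol{x}/\|\boldsymbol{x}\|$. The state $|\tilde{\boldsymbol{x}}\rangle$ is a unit vector in $\mathbb{C}^{NM}$; $\tilde{\boldsymbol{x}}=(\tilde x^{(1)},\dots,\tilde x^{(M)})^T$, with $\tilde x^{(j)}\in\mathbb{C}^N$, is a nonzero vector with $|\tilde{\boldsymbol{x}}\rangle=\tilde{\boldsymbol{x}}/\|\tilde{\boldsymbol{x}}\|$. The algorithm prepares in Step 1 a state $|\tilde{\boldsymbol{x}}\rangle$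 approximating $|\boldsymbol{x}\rangle$, and its remaining steps produce (after successful measurement) the state proportional to $(A-I)\sum_j\omega_j\tilde x^{(j)}$. Define $$\boldsymbol{f}=\frac{1}{\|\boldsymbol{x}\|}\log(A)b,\qquad \tilde{\boldsymbol{f}}=\frac{1}{\|\tilde{\boldsymbol{x}}\|}(A-I)\sum_{j=1}^M\omega_j\tilde x^{(j)},$$ and $|f\rangle=\boldsymbol{f}/\|\boldsymbol{f}\|=\log(A)|b\rangle/\|\log(A)|b\rangle\|$ (the target state), $|\tilde f\rangle=\tilde{\boldsymbol{f}}/\|\tilde{\boldsymbol{f}}\|$ (the actual output state). *)

theory Defs
  imports "HOL-Analysis.Analysis" "HOL-Computational_Algebra.Polynomial"
    "HOL-Library.Landau_Symbols"
begin

text \<open>The dimensions \<open>N\<close> and \<open>M\<close> are the cardinalities of the finite index types \<open>'n\<close> and \<open>'m\<close>;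
  the space of vectors with \<open>M\<close> blocks of length \<open>N\<close> is \<open>complex ^ ('m \<times> 'n)\<close>,
  whose library norm is the Euclidean one.\<close>

text \<open>The library has \<open>sgn v = v /\<^sub>R norm v\<close> in every real normed space.\<close>

abbreviation ket :: "'a::real_normed_vector \<Rightarrow> 'a" where
  "ket v \<equiv> sgn v"

definition opnorm :: "complex ^ 'n ^ 'n \<Rightarrow> real" where
  "opnorm A = onorm (\<lambda>v. A *v v)"

text \<open>The library multiplication and power on \<open>complex ^ 'n ^ 'n\<close> act componentwise,
  hence the explicit iteration of the matrix product.\<close>

definition matrix_exp :: "complex ^ 'n ^ 'n \<Rightarrow> complex ^ 'n ^ 'n" where
  "matrix_exp X = (\<Sum>k. (1 / fact k) *\<^sub>R (((**) X ^^ k) (mat 1)))"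

definition matrix_eigenvalue :: "complex ^ 'n ^ 'n \<Rightarrow> complex \<Rightarrow> bool" where
  "matrix_eigenvalue X \<mu> \<longleftrightarrow> (\<exists>v. v \<noteq> 0 \<and> X *v v = \<mu> *s v)"

text \<open>The principal logarithm of a matrix without eigenvalues on the closed negative real axis
  is its unique logarithm all of whose eigenvalues lie in the strip \<open>\<bar>Im z\<bar> < pi\<close>.\<close>

definition principal_log :: "complex ^ 'n ^ 'n \<Rightarrow> complex ^ 'n ^ 'n" where
  "principal_log A = (THE X. matrix_exp X = A \<and>
     (\<forall>\<mu>. matrix_eigenvalue X \<mu> \<longrightarrow> \<bar>Im \<mu>\<bar> < pi))"

text \<open>Rodrigues' formula.\<close>

definition legendre_poly :: "nat \<Rightarrow> real poly" where
  "legendre_poly n = smult (1 / (2 ^ n * fact n)) ((pderiv ^^ n) ([:-1, 0, 1:] ^ n))"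

text \<open>The nodes enumerate the zeros of the Legendre polynomial of degree \<open>M\<close> (in any order),
  and the weights are the integrals of the Lagrange basis polynomials at the nodes.\<close>

definition gauss_legendre :: "('m::finite \<Rightarrow> real) \<Rightarrow> ('m \<Rightarrow> real) \<Rightarrow> bool" where
  "gauss_legendre t s \<longleftrightarrow>
     bij_betw t UNIV {x. poly (legendre_poly CARD('m)) x = 0} \<and>
     (\<forall>j. s j = integral {-1..1} (\<lambda>x. \<Prod>k\<in>UNIV - {j}. (x - t k) / (t j - t k)))"

text \<open>Requiring lowest terms makes numerator and denominator unique and excludes
  spurious zeros of the denominator.\<close>

definition is_pade :: "(real \<Rightarrow> real) \<Rightarrow> nat \<Rightarrow> nat \<Rightarrow> real poly \<Rightarrow> real poly \<Rightarrow> bool" where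
  "is_pade f k m p q \<longleftrightarrow>
     degree p \<le> k \<and> degree q \<le> m \<and> poly q 0 = 1 \<and> coprime p q \<and>
     (\<lambda>x. f x - poly p x / poly q x) \<in> O[at 0](\<lambda>x. x ^ (k + m + 1))"

definition pade :: "(real \<Rightarrow> real) \<Rightarrow> nat \<Rightarrow> nat \<Rightarrow> real \<Rightarrow> real" where
  "pade f k m x = (case (THE (p, q). is_pade f k m p q) of (p, q) \<Rightarrow> poly p x / poly q x)"

definition r_log :: "nat \<Rightarrow> real \<Rightarrow> real" where
  "r_log M = pade (\<lambda>x. ln (1 + x)) M M"

definition block_diag :: "('m::finite \<Rightarrow> complex ^ 'n ^ 'n) \<Rightarrow> complex ^ ('m \<times> 'n) ^ ('m \<times> 'n)" where
  "block_diag B = (\<chi> r c. if fst r = fst c then B (fst r) $ snd r $ snd c else 0)"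

definition block :: "complex ^ ('m::finite \<times> 'n) \<Rightarrow> 'm \<Rightarrow> complex ^ 'n" where
  "block v j = (\<chi> i. v $ (j, i))"

definition copies :: "complex ^ 'n \<Rightarrow> complex ^ ('m::finite \<times> 'n)" where
  "copies b = (\<chi> r. b $ snd r)"

definition unit_nodes :: "('m \<Rightarrow> real) \<Rightarrow> 'm \<Rightarrow> real" where
  "unit_nodes t j = t j / 2 + 1 / 2"

definition unit_weights :: "('m \<Rightarrow> real) \<Rightarrow> 'm \<Rightarrow> real" where
  "unit_weights s j = s j / 2"

definition system_matrix ::
    "('m::finite \<Rightarrow> real) \<Rightarrow> complex ^ 'n ^ 'n \<Rightarrow> complex ^ ('m \<times> 'n) ^ ('m \<times> 'n)" where
  "system_matrix \<tau> A = block_diag (\<lambda>j. \<tau> j *\<^sub>R (A - mat 1) + mat 1)"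

definition target_vector ::
    "complex ^ 'n ^ 'n \<Rightarrow> complex ^ 'n \<Rightarrow> complex ^ ('m::finite \<times> 'n) \<Rightarrow> complex ^ 'n" where
  "target_vector A b x = (1 / norm x) *\<^sub>R (principal_log A *v b)"

definition output_vector ::
    "('m::finite \<Rightarrow> real) \<Rightarrow> complex ^ 'n ^ 'n \<Rightarrow> complex ^ ('m::finite \<times> 'n) \<Rightarrow> complex ^ 'n" where
  "output_vector \<omega> A y =
     (1 / norm y) *\<^sub>R ((A - mat 1) *v (\<Sum>j\<in>UNIV. \<omega> j *\<^sub>R block y j))"

definition K_const :: "complex ^ 'n ^ 'n \<Rightarrow> complex ^ 'n \<Rightarrow> real" where
  "K_const A b = norm (principal_log A *v ket b) * (1 - opnorm (A - mat 1))"

definition eps_pade :: "nat \<Rightarrow> complex ^ 'n ^ 'n \<Rightarrow> real" where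
  "eps_pade M A =
     \<bar>r_log M (- opnorm (A - mat 1)) - ln (1 - opnorm (A - mat 1))\<bar>"

definition delta_const :: "('m::finite \<Rightarrow> real) \<Rightarrow> complex ^ 'n ^ 'n \<Rightarrow> real" where
  "delta_const \<omega> A = opnorm (A - mat 1) * sqrt (\<Sum>j\<in>UNIV. \<bar>\<omega> j\<bar> ^ 2)"

end

theory Submission
  imports Defs
    "HOL-Computational_Algebra.Fundamental_Theorem_Algebra"
    "HOL-Computational_Algebra.Polynomial_Factorial"
    "HOL-Computational_Algebra.Field_as_Ring"
begin

text \<open>Write \<open>E = A - I\<close> and \<open>\<rho> = \<parallel>E\<parallel> < 1\<close>.  Unnormalised, the output differs from the target in two ways: the
logarithm is replaced by a quadrature sum, and the exact solution of the linear system by an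
approximate one.

For the first error, \<open>ln (1 + z) = \<integral> z / (1 + u z) du\<close> over \<open>[0, 1]\<close>, so Gauss quadrature turns the
logarithm into a rational function of \<open>z\<close>, and the difference of the two is the power series
\<open>\<Sum>k. (-1)^k c\<^sub>k z^(k+1)\<close>, where \<open>c\<^sub>k\<close> is the quadrature error for the monomial \<open>u^k\<close>.  Two facts about
\<open>c\<^sub>k\<close> carry the argument.  It vanishes for \<open>k < 2M\<close> (\<open>unit_moment_exact\<close>), so the rational function
agrees with the logarithm to order \<open>2M + 1\<close> and is the Pade approximant, by uniqueness of the latter
(\<open>r_log_eq_quadrature\<close>).  And it is never negative (\<open>unit_moment_le\<close>), so at \<open>z = -\<rho>\<close> all terms of the
error series have the same sign: the scalar error there is exactly \<open>\<Sum>k. c\<^sub>k \<rho>^(k+1)\<close>, which bounds the norm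
of the same series evaluated at the matrix \<open>E\<close> (\<open>log_quadrature_error\<close>).

The second error is at most \<open>\<rho>\<close> times a weighted sum of the blocks of the difference of the two states,
and the Cauchy-Schwarz inequality bounds that sum (\<open>norm_weighted_block_sum_le\<close>).  Normalising costs
at most a factor 2 relative to the norm of the target (\<open>norm_sgn_diff_le\<close>).  That norm is
\<open>\<parallel>log(A) b\<parallel> / \<parallel>x\<parallel>\<close>, and each block of \<open>x\<close> has norm at most \<open>\<parallel>b\<parallel> / (1 - \<rho>)\<close>; this is where the factors
\<open>sqrt M\<close> and \<open>1 - \<rho>\<close> come from.

To evaluate power series at a matrix, the principal logarithm, defined through eigenvalues, must first
be identified with the logarithmic series (\<open>principal_log_eq\<close>).  That the series is a
logarithm follows by differentiating along the path \<open>I + tE\<close>.  For uniqueness, two commuting logarithms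
\<open>X\<close> and \<open>L\<close> with eigenvalues in the strip have a difference \<open>Z\<close> with \<open>exp Z = I\<close>; a common eigenvector of
\<open>Z\<close> and \<open>X\<close> shows that 0 is the only eigenvalue of \<open>Z\<close>, whence \<open>(exp Z - I) / Z\<close> is injective and \<open>Z = 0\<close>.\<close>

section \<open>The Banach algebra of endomorphisms\<close>

text \<open>The class multiplication on \<open>complex ^ 'n ^ 'n\<close> is the componentwise one.  A copy of the bounded operators,
multiplied by composition and normed by the operator norm, is a Banach algebra for the type classes,
so that \<open>exp\<close> and its functional equation apply to it.\<close>

typedef (overloaded) 'a endo = "UNIV :: ('a::euclidean_space \<Rightarrow>\<^sub>L 'a) set"
  morphisms blinfun_of_endo Endo ..

setup_lifting type_definition_endo

instantiation endo :: (euclidean_space) real_normed_algebra_1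
begin

lift_definition zero_endo :: "'a endo" is "0" .
lift_definition one_endo :: "'a endo" is "id_blinfun" .
lift_definition plus_endo :: "'a endo \<Rightarrow> 'a endo \<Rightarrow> 'a endo" is "(+)" .
lift_definition minus_endo :: "'a endo \<Rightarrow> 'a endo \<Rightarrow> 'a endo" is "(-)" .
lift_definition uminus_endo :: "'a endo \<Rightarrow> 'a endo" is "uminus" .
lift_definition times_endo :: "'a endo \<Rightarrow> 'a endo \<Rightarrow> 'a endo" is "(o\<^sub>L)" .
lift_definition scaleR_endo :: "real \<Rightarrow> 'a endo \<Rightarrow> 'a endo" is "scaleR" .
lift_definition norm_endo :: "'a endo \<Rightarrow> real" is "norm" .

definition "dist (S :: 'a endo) T = norm (S - T)"
definition "sgn (T :: 'a endo) = inverse (norm T) *\<^sub>R T"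
definition "(uniformity :: ('a endo \<times> 'a endo) filter) = (INF e\<in>{0 <..}. principal {(S, T). dist S T < e})"
definition "open (U :: 'a endo set) \<longleftrightarrow> (\<forall>T\<in>U. eventually (\<lambda>(T', S). T' = T \<longrightarrow> S \<in> U) uniformity)"

instance
proof
  fix R S T :: "'a endo" and a b :: real and U :: "'a endo set"
  show "dist S T = norm (S - T)" by (rule dist_endo_def)
  show "sgn T = inverse (norm T) *\<^sub>R T" by (rule sgn_endo_def)
  show "(uniformity :: ('a endo \<times> 'a endo) filter) = (INF e\<in>{0 <..}. principal {(S, T). dist S T < e})"
    by (rule uniformity_endo_def)
  show "open U \<longleftrightarrow> (\<forall>T\<in>U. eventually (\<lambda>(T', S). T' = T \<longrightarrow> S \<in> U) uniformity)"
    by (rule open_endo_def)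
  show "R + S + T = R + (S + T)" by transfer simp
  show "S + T = T + S" by transfer simp
  show "0 + T = T" by transfer simp
  show "- T + T = 0" by transfer simp
  show "S - T = S + - T" by transfer simp
  show "R * S * T = R * (S * T)" by transfer (auto intro!: blinfun_eqI)
  show "1 * T = T" by transfer (auto intro!: blinfun_eqI)
  show "T * 1 = T" by transfer (auto intro!: blinfun_eqI)
  show "(R + S) * T = R * T + S * T" by transfer (auto intro!: blinfun_eqI simp: blinfun.bilinear_simps)
  show "R * (S + T) = R * S + R * T" by transfer (auto intro!: blinfun_eqI simp: blinfun.bilinear_simps)
  show "a *\<^sub>R (S + T) = a *\<^sub>R S + a *\<^sub>R T" by transfer (simp add: scaleR_add_right)
  show "(a + b) *\<^sub>R T = a *\<^sub>R T + b *\<^sub>R T" by transfer (simp add: scaleR_add_left)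
  show "a *\<^sub>R b *\<^sub>R T = (a * b) *\<^sub>R T" by transfer simp
  show "1 *\<^sub>R T = T" by transfer simp
  show "a *\<^sub>R S * T = a *\<^sub>R (S * T)" by transfer (auto intro!: blinfun_eqI simp: blinfun.bilinear_simps)
  show "S * a *\<^sub>R T = a *\<^sub>R (S * T)" by transfer (auto intro!: blinfun_eqI simp: blinfun.bilinear_simps)
  show "norm T = 0 \<longleftrightarrow> T = 0" by transfer simp
  show "norm (S + T) \<le> norm S + norm T" by transfer (rule norm_triangle_ineq)
  show "norm (a *\<^sub>R T) = \<bar>a\<bar> * norm T" by transfer simp
  show "norm (S * T) \<le> norm S * norm T" by transfer (rule norm_blinfun_compose)
  show "norm (1 :: 'a endo) = 1" by transfer (rule norm_blinfun_id)
  show "(0 :: 'a endo) \<noteq> 1"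
  proof
    assume "(0 :: 'a endo) = 1"
    moreover have "norm (0 :: 'a endo) = 0" by transfer simp
    moreover have "norm (1 :: 'a endo) = 1" by transfer (rule norm_blinfun_id)
    ultimately show False by simp
  qed
qed

end

instance endo :: (euclidean_space) banach
proof
  fix X :: "nat \<Rightarrow> 'a endo"
  assume X: "Cauchy X"
  have dist_eq: "dist (blinfun_of_endo S) (blinfun_of_endo T) = dist S T" for S T :: "'a endo"
    unfolding dist_norm by transfer simp
  have "Cauchy (\<lambda>n. blinfun_of_endo (X n))"
    using X by (simp add: Cauchy_def dist_eq)
  then obtain L where "(\<lambda>n. blinfun_of_endo (X n)) \<longlonglongrightarrow> L"
    using Cauchy_convergent convergent_def by blast
  then have "(\<lambda>n. blinfun_of_endo (X n)) \<longlonglongrightarrow> blinfun_of_endo (Endo L)"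
    by (simp add: Endo_inverse)
  then have "X \<longlonglongrightarrow> Endo L"
    unfolding lim_sequentially dist_eq .
  then show "convergent X" by (auto simp: convergent_def)
qed

lift_definition endo_apply :: "'a::euclidean_space endo \<Rightarrow> 'a \<Rightarrow> 'a" is blinfun_apply .

lemma endo_eqI: "(\<And>v. endo_apply S v = endo_apply T v) \<Longrightarrow> S = T"
  by transfer (rule blinfun_eqI)

lemma endo_apply_mult [simp]: "endo_apply (S * T) v = endo_apply S (endo_apply T v)"
  by transfer simp

lemma endo_apply_one [simp]: "endo_apply 1 v = v"
  by transfer simp

lemma norm_endo_apply: "norm (endo_apply T v) \<le> norm T * norm v"
  by transfer (rule norm_blinfun)

lemma bounded_bilinear_endo_apply: "bounded_bilinear endo_apply"
proof
  fix S T :: "'a endo" and v w :: 'a and r :: real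
  show "endo_apply (S + T) v = endo_apply S v + endo_apply T v"
    by transfer (simp add: blinfun.bilinear_simps)
  show "endo_apply S (v + w) = endo_apply S v + endo_apply S w"
    by transfer (simp add: blinfun.bilinear_simps)
  show "endo_apply (r *\<^sub>R S) v = r *\<^sub>R endo_apply S v"
    by transfer (simp add: blinfun.bilinear_simps)
  show "endo_apply S (r *\<^sub>R v) = r *\<^sub>R endo_apply S v"
    by transfer (simp add: blinfun.bilinear_simps)
  show "\<exists>K. \<forall>(T::'a endo) v. norm (endo_apply T v) \<le> norm T * norm v * K"
    by (rule exI[of _ 1]) (simp add: norm_endo_apply)
qed

interpretation endo_apply: bounded_bilinear endo_apply
  by (rule bounded_bilinear_endo_apply)

lift_definition endo_of_matrix :: "complex ^ 'n ^ 'n \<Rightarrow> (complex ^ 'n) endo"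
  is "\<lambda>X. Blinfun (\<lambda>v. X *v v)" .

text \<open>Matrices embed isometrically as an algebra (\<open>endo_of_matrix_simps\<close>, \<open>norm_endo_of_matrix\<close>), so identities
proved for operators descend by injectivity.\<close>

definition mat_pow :: "complex ^ 'n ^ 'n \<Rightarrow> nat \<Rightarrow> complex ^ 'n ^ 'n" where
  "mat_pow X k = ((**) X ^^ k) (mat 1)"

lemma linear_matrix_vector: "bounded_linear (\<lambda>v. (X :: complex ^ 'n ^ 'm) *v v)"
  by (rule linear_conv_bounded_linear[THEN iffD1]) simp

lemma endo_apply_matrix [simp]: "endo_apply (endo_of_matrix X) v = X *v v"
  by transfer (simp add: bounded_linear_Blinfun_apply linear_matrix_vector)

lemma norm_endo_of_matrix: "norm (endo_of_matrix X) = opnorm X"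
  unfolding opnorm_def
  by transfer (simp add: norm_blinfun.rep_eq bounded_linear_Blinfun_apply linear_matrix_vector)

lemma matrix_scaleR_vector: "(r *\<^sub>R X) *v v = r *\<^sub>R (X *v (v :: complex ^ 'n))"
  by (simp add: vec_eq_iff matrix_vector_mult_def scaleR_sum_right)

lemma endo_of_matrix_simps:
  "endo_of_matrix (X + Y) = endo_of_matrix X + endo_of_matrix Y"
  "endo_of_matrix (X - Y) = endo_of_matrix X - endo_of_matrix Y"
  "endo_of_matrix (X ** Y) = endo_of_matrix X * endo_of_matrix Y"
  "endo_of_matrix (r *\<^sub>R X) = r *\<^sub>R endo_of_matrix X"
  "endo_of_matrix (mat 1) = 1"
  by (auto intro!: endo_eqI simp: matrix_vector_mult_add_rdistrib matrix_vector_mult_diff_rdistrib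
      endo_apply.add_left endo_apply.diff_left endo_apply.scaleR_left matrix_scaleR_vector
      matrix_vector_mul_assoc)

lemma endo_of_mat_pow: "endo_of_matrix (mat_pow X k) = endo_of_matrix X ^ k"
  by (induction k) (simp_all add: mat_pow_def endo_of_matrix_simps)

lemma inj_endo_of_matrix: "endo_of_matrix X = endo_of_matrix Y \<Longrightarrow> X = Y"
  using endo_apply_matrix[of X] endo_apply_matrix[of Y] by (simp add: matrix_eq)

lemma bounded_linear_endo_of_matrix: "bounded_linear endo_of_matrix"
  by (rule linear_conv_bounded_linear[THEN iffD1]) (auto intro!: linearI simp: endo_of_matrix_simps)

text \<open>A continuous left inverse of the embedding transports convergence back to matrices, where limits are
taken in a norm other than the operator norm.\<close>

definition matrix_of_endo :: "(complex ^ 'n) endo \<Rightarrow> complex ^ 'n ^ 'n" where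
  "matrix_of_endo T = (\<chi> i j. endo_apply T (axis j 1) $ i)"

lemma matrix_of_endo_of_matrix: "matrix_of_endo (endo_of_matrix X) = X"
proof -
  have "(X *v axis j 1) $ i = X $ i $ j" for i j
    unfolding matrix_vector_mult_def axis_def vec_lambda_beta
    by (subst sum.remove[of _ j]) auto
  then show ?thesis by (simp add: matrix_of_endo_def vec_eq_iff)
qed

lemma tendsto_matrix_of_endo:
  assumes "(f \<longlongrightarrow> T) F" shows "((\<lambda>x. matrix_of_endo (f x)) \<longlongrightarrow> matrix_of_endo T) F"
  unfolding matrix_of_endo_def
  by (rule tendsto_vec_lambda, rule tendsto_vec_lambda, rule tendsto_vec_nth,
      rule endo_apply.tendsto[OF assms tendsto_const])

lemma summable_matrixI:
  assumes "summable (\<lambda>k. endo_of_matrix (f k))"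
  shows "summable f"
proof -
  obtain T where "(\<lambda>n. \<Sum>k<n. endo_of_matrix (f k)) \<longlonglongrightarrow> T"
    using assms by (auto simp: summable_def sums_def)
  from tendsto_matrix_of_endo[OF this]
  have "(\<lambda>n. matrix_of_endo (endo_of_matrix (\<Sum>k<n. f k))) \<longlonglongrightarrow> matrix_of_endo T"
    by (simp add: linear_sum[OF bounded_linear.linear[OF bounded_linear_endo_of_matrix]])
  then show ?thesis
    by (auto simp: summable_def sums_def matrix_of_endo_of_matrix)
qed

lemma endo_of_matrix_suminf:
  assumes "summable (\<lambda>k. endo_of_matrix (f k))"
  shows "endo_of_matrix (\<Sum>k. f k) = (\<Sum>k. endo_of_matrix (f k))"
  by (rule bounded_linear.suminf[OF bounded_linear_endo_of_matrix summable_matrixI[OF assms]])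

lemma endo_of_matrix_exp: "endo_of_matrix (matrix_exp X) = exp (endo_of_matrix X)"
  unfolding matrix_exp_def mat_pow_def[symmetric] exp_def
  by (subst endo_of_matrix_suminf)
     (simp_all add: endo_of_matrix_simps endo_of_mat_pow divide_inverse summable_exp_generic)

section \<open>Exponential and logarithmic series in a Banach algebra\<close>

lemma has_derivative_exp_zero:
  "(exp has_derivative (\<lambda>h. h)) (at (0 :: 'a :: {real_normed_algebra_1, banach}))"
  unfolding has_derivative_at
proof (intro conjI)
  show "bounded_linear (\<lambda>h::'a. h)" by (rule bounded_linear_ident)
  have "norm (exp h - 1 - h) \<le> norm h ^ 2" if "norm h \<le> 1" for h :: 'a
  proof -
    have s: "summable (\<lambda>n. norm (inverse (fact (n + 2)) *\<^sub>R h ^ (n + 2)))"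
      using summable_norm_exp[of h] by (subst summable_iff_shift)
    have s': "summable (\<lambda>n. inverse (fact (n + 2)) *\<^sub>R norm h ^ (n + 2))"
      using summable_exp_generic[of "norm h"] by (subst summable_iff_shift)
    have "norm (exp h - 1 - h) = norm (\<Sum>n. inverse (fact (n + 2)) *\<^sub>R h ^ (n + 2))"
      by (simp add: exp_first_two_terms[of h])
    also have "\<dots> \<le> (\<Sum>n. norm (inverse (fact (n + 2)) *\<^sub>R h ^ (n + 2)))"
      by (rule summable_norm[OF s])
    also have "\<dots> \<le> (\<Sum>n. inverse (fact (n + 2)) *\<^sub>R norm h ^ (n + 2))"
    proof (rule suminf_le[OF _ s s'])
      show "norm (inverse (fact (n + 2)) *\<^sub>R h ^ (n + 2)) \<le> inverse (fact (n + 2)) *\<^sub>R norm h ^ (n + 2)" for n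
        using mult_left_mono[OF norm_power_ineq[of h "n + 2"], of "inverse (fact (n + 2))"]
        by simp
    qed
    also have "\<dots> = exp (norm h) - 1 - norm h"
      by (simp add: exp_first_two_terms[of "norm h"])
    also have "\<dots> \<le> norm h ^ 2"
      using exp_bound[of "norm h"] that by simp
    finally show ?thesis .
  qed
  then have "norm (norm (exp (0 + h) - exp 0 - h) / norm h) \<le> norm h" if "norm h \<le> 1" for h :: 'a
    using that by (cases "h = 0") (auto simp: divide_simps power2_eq_square)
  then have "\<forall>\<^sub>F h in at (0::'a). norm (norm (exp (0 + h) - exp 0 - h) / norm h) \<le> norm h"
    unfolding eventually_at by (intro exI[of _ 1]) auto
  then show "(\<lambda>h. norm (exp (0 + h) - exp 0 - h) / norm h) \<midarrow>(0::'a)\<rightarrow> 0"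
    by (rule Lim_null_comparison) (auto intro!: tendsto_eq_intros)
qed

text \<open>Commutation allows \<open>exp (f t)\<close> to be split off from \<open>exp (f s)\<close>, which leaves only the derivative of
\<open>exp\<close> at 0.\<close>

lemma has_vector_derivative_exp_commuting:
  fixes f :: "real \<Rightarrow> 'a :: {real_normed_algebra_1, banach}"
  assumes f: "(f has_vector_derivative D) (at t within S)" and t: "t \<in> S"
    and comm: "\<And>s. s \<in> S \<Longrightarrow> f s * f t = f t * f s"
  shows "((\<lambda>s. exp (f s)) has_vector_derivative exp (f t) * D) (at t within S)"
proof -
  have "((\<lambda>s. f s - f t) has_derivative (\<lambda>h. h *\<^sub>R D)) (at t within S)"
    using f by (auto simp: has_vector_derivative_def intro!: derivative_eq_intros)
  then have "((\<lambda>s. exp (f s - f t)) has_derivative (\<lambda>h. h *\<^sub>R D)) (at t within S)"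
    by (rule has_derivative_compose[where g = exp and g' = "\<lambda>h. h"])
       (simp add: has_derivative_exp_zero)
  then have "((\<lambda>s. exp (f t) * exp (f s - f t)) has_vector_derivative exp (f t) * D) (at t within S)"
    unfolding has_vector_derivative_def
    by (rule has_derivative_eq_rhs[OF has_derivative_mult_right]) simp
  moreover have "exp (f t) * exp (f s - f t) = exp (f s)" if "s \<in> S" for s
    using exp_add_commuting[of "f t" "f s - f t"] comm[OF that] by (simp add: algebra_simps)
  ultimately show ?thesis
    by (intro has_vector_derivative_transform[OF t _, of "\<lambda>s. exp (f s)"]) auto
qed

lemma commutes_suminf:
  fixes T :: "'a :: real_normed_algebra"
  assumes "summable f" "\<And>k. T * f k = f k * T"
  shows "T * suminf f = suminf f * T"
  using suminf_mult[OF assms(1), of T] suminf_mult2[OF assms(1), of T] assms(2) by simp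

definition log_series :: "'a :: {real_normed_algebra_1, banach} \<Rightarrow> 'a" where
  "log_series e = (\<Sum>k. ((- 1) ^ k / real (Suc k)) *\<^sub>R e ^ Suc k)"

lemma norm_power_series_term_le:
  fixes e :: "'a :: real_normed_algebra_1"
  assumes "\<bar>c\<bar> \<le> 1"
  shows "norm (c *\<^sub>R e ^ k) \<le> norm e ^ k"
proof -
  have "norm (c *\<^sub>R e ^ k) = \<bar>c\<bar> * norm (e ^ k)" by simp
  also have "\<dots> \<le> 1 * norm e ^ k"
    by (intro mult_mono assms norm_power_ineq) auto
  finally show ?thesis by simp
qed

lemma summable_bounded_power_series:
  fixes e :: "'a :: {real_normed_algebra_1, banach}"
  assumes e: "norm e < 1" and c: "\<And>k. \<bar>c k\<bar> \<le> 1"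
  shows "summable (\<lambda>k. c k *\<^sub>R e ^ k)" "summable (\<lambda>k. c k *\<^sub>R e ^ Suc k)"
proof -
  have g: "summable (\<lambda>k. norm e ^ k)" "summable (\<lambda>k. norm e ^ Suc k)"
    using summable_geometric[of "norm e"] e summable_ignore_initial_segment[of "\<lambda>k. norm e ^ k" 1] by auto
  show "summable (\<lambda>k. c k *\<^sub>R e ^ k)"
    by (rule summable_comparison_test'[OF g(1)]) (rule norm_power_series_term_le[OF c])
  show "summable (\<lambda>k. c k *\<^sub>R e ^ Suc k)"
    by (rule summable_comparison_test'[OF g(2)]) (rule norm_power_series_term_le[OF c])
qed

lemma geometric_series_inverse:
  fixes e :: "'a :: {real_normed_algebra_1, banach}"
  assumes e: "norm e < 1"
  shows "(\<Sum>k. (- 1) ^ k *\<^sub>R e ^ k) * (1 + e) = 1"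
proof -
  have s: "summable (\<lambda>k. (- 1) ^ k *\<^sub>R e ^ k)"
    by (rule summable_bounded_power_series[OF e]) simp
  have "(\<Sum>k. (- 1) ^ k *\<^sub>R e ^ k) * e = (\<Sum>k. (- 1) ^ k *\<^sub>R e ^ Suc k)"
    by (subst suminf_mult2[OF s]) (simp add: power_commutes)
  also have "\<dots> = - (\<Sum>k. (- 1) ^ Suc k *\<^sub>R e ^ Suc k)"
    using suminf_minus[of "\<lambda>k. (- 1) ^ Suc k *\<^sub>R e ^ Suc k"]
       summable_bounded_power_series(2)[OF e, of "\<lambda>k. (- 1) ^ Suc k"] by simp
  also have "\<dots> = 1 - (\<Sum>k. (- 1) ^ k *\<^sub>R e ^ k)"
    using suminf_split_head[OF s] by simp
  finally show ?thesis by (simp add: distrib_left)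
qed

text \<open>Let \<open>g t\<close> be the series at \<open>t e\<close>.  Its derivative is \<open>e (1 + t e)\<^sup>-\<^sup>1\<close>, so
\<open>exp (- g t) (1 + t e)\<close> has derivative 0 and keeps its value 1 from \<open>t = 0\<close> to \<open>t = 1\<close>.\<close>

lemma exp_log_series:
  fixes e :: "'a :: {real_normed_algebra_1, banach}"
  assumes e: "norm e < 1"
  shows "exp (log_series e) = 1 + e"
proof -
  let ?S = "{0..1::real}"
  define f where "f k t = ((- 1) ^ k / real (Suc k)) *\<^sub>R (t *\<^sub>R e) ^ Suc k" for k t
  define d where "d k t = ((- t) ^ k) *\<^sub>R e ^ Suc k" for k :: nat and t :: real
  have te: "norm (t *\<^sub>R e) < 1" if "t \<in> ?S" for t
    using e that mult_mono[of t 1 "norm e" "norm e"] by simp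
  have sum_d: "(\<Sum>k. d k t) * (1 + t *\<^sub>R e) = e" if t: "t \<in> ?S" for t
  proof -
    have "(\<lambda>k. (- 1) ^ k *\<^sub>R (t *\<^sub>R e) ^ k) sums (\<Sum>k. (- 1) ^ k *\<^sub>R (t *\<^sub>R e) ^ k)"
      by (rule summable_sums, rule summable_bounded_power_series[OF te[OF t]]) simp
    from sums_mult[OF this, of e]
    have "(\<lambda>k. d k t) sums (e * (\<Sum>k. (- 1) ^ k *\<^sub>R (t *\<^sub>R e) ^ k))"
      by (simp add: d_def power_minus[of t])
    then have "(\<Sum>k. d k t) = e * (\<Sum>k. (- 1) ^ k *\<^sub>R (t *\<^sub>R e) ^ k)"
      by (rule sums_unique[symmetric])
    then show ?thesis
      using geometric_series_inverse[OF te[OF t]] by (simp add: mult.assoc)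
  qed
  \<comment> \<open>The geometric majorant does not depend on \<open>t\<close>, hence termwise differentiation.\<close>
  have unif: "uniform_limit ?S (\<lambda>n t. \<Sum>k<n. d k t) (\<lambda>t. \<Sum>k. d k t) sequentially"
  proof (rule Weierstrass_m_test)
    show "norm (d k t) \<le> norm e ^ Suc k" if "t \<in> ?S" for k t
      unfolding d_def using that by (intro norm_power_series_term_le) (simp add: power_abs power_le_one)
    show "summable (\<lambda>k. norm e ^ Suc k)"
      using summable_bounded_power_series(2)[of "norm e" "\<lambda>_. 1"] e by simp
  qed
  have "\<exists>g. \<forall>t\<in>?S. (\<lambda>k. f k t) sums g t \<and>
      (g has_derivative (\<lambda>h. h *\<^sub>R (\<Sum>k. d k t))) (at t within ?S)"
  proof (rule has_derivative_series[where f' = "\<lambda>k t h. h *\<^sub>R d k t" and x = 0 and l = 0])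
    show "convex ?S" by simp
    show "(f k has_derivative (\<lambda>h. h *\<^sub>R d k t)) (at t within ?S)" for k t
    proof -
      have "((\<lambda>t. ((- 1) ^ k / real (Suc k)) * t ^ Suc k) has_real_derivative (- t) ^ k) (at t within ?S)"
        by (rule derivative_eq_intros refl)+ (simp add: power_minus[of t])
      then have "((\<lambda>t. (((- 1) ^ k / real (Suc k)) * t ^ Suc k) *\<^sub>R e ^ Suc k) has_vector_derivative
          (- t) ^ k *\<^sub>R e ^ Suc k) (at t within ?S)"
        by (rule has_vector_derivative_scaleR[OF _ has_vector_derivative_const, THEN has_vector_derivative_eq_rhs]) simp
      moreover have "f k = (\<lambda>t. (((- 1) ^ k / real (Suc k)) * t ^ Suc k) *\<^sub>R e ^ Suc k)"
        by (simp add: f_def fun_eq_iff)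
      ultimately show ?thesis
        by (simp add: d_def has_vector_derivative_def)
    qed
    show "\<forall>\<^sub>F n in sequentially. \<forall>t\<in>?S. \<forall>h. norm ((\<Sum>k<n. h *\<^sub>R d k t) - h *\<^sub>R (\<Sum>k. d k t)) \<le> r * norm h"
      if "r > 0" for r
      using uniform_limitD[OF unif that]
    proof eventually_elim
      case (elim n)
      show ?case
      proof (intro ballI allI)
        fix t h :: real assume "t \<in> ?S"
        with elim have "norm ((\<Sum>k<n. d k t) - (\<Sum>k. d k t)) \<le> r" by (auto simp: dist_norm less_imp_le)
        then have "\<bar>h\<bar> * norm ((\<Sum>k<n. d k t) - (\<Sum>k. d k t)) \<le> \<bar>h\<bar> * r" by (intro mult_left_mono) auto
        then show "norm ((\<Sum>k<n. h *\<^sub>R d k t) - h *\<^sub>R (\<Sum>k. d k t)) \<le> r * norm h"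
          by (simp add: scaleR_sum_right[symmetric] scaleR_diff_right[symmetric] mult.commute)
      qed
    qed
    show "(\<lambda>k. f k 0) sums 0" by (simp add: f_def)
  qed simp
  then obtain g where g: "\<And>t. t \<in> ?S \<Longrightarrow> (\<lambda>k. f k t) sums g t"
    and dg: "\<And>t. t \<in> ?S \<Longrightarrow> (g has_vector_derivative (\<Sum>k. d k t)) (at t within ?S)"
    unfolding has_vector_derivative_def by blast
  have g_sum: "g t = (\<Sum>k. f k t)" and g_summable: "summable (\<lambda>k. f k t)" if "t \<in> ?S" for t
    using g[OF that] by (auto simp: sums_iff)
  have e_comm: "e * g t = g t * e" if "t \<in> ?S" for t
    unfolding g_sum[OF that]
    by (rule commutes_suminf[OF g_summable[OF that]]) (simp add: f_def power_commutes mult.assoc)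
  have pow_comm: "e ^ k * g t = g t * e ^ k" if "t \<in> ?S" for t k
    using e_comm[OF that] by (induction k) (simp_all add: mult.assoc, metis mult.assoc)
  have comm: "g s * g t = g t * g s" if "s \<in> ?S" "t \<in> ?S" for s t
  proof -
    have "g t * suminf (\<lambda>k. f k s) = suminf (\<lambda>k. f k s) * g t"
      by (rule commutes_suminf[OF g_summable[OF that(1)]])
         (simp add: f_def pow_comm[OF that(2)] flip: power_Suc)
    then show ?thesis by (simp add: g_sum[OF that(1)])
  qed
  define F where "F t = exp (- g t) * (1 + t *\<^sub>R e)" for t
  have dF: "(F has_vector_derivative 0) (at t within ?S)" if t: "t \<in> ?S" for t
  proof -
    have "((\<lambda>t. - g t) has_vector_derivative - (\<Sum>k. d k t)) (at t within ?S)"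
      by (auto intro!: derivative_eq_intros dg t)
    then have "((\<lambda>t. exp (- g t)) has_vector_derivative exp (- g t) * - (\<Sum>k. d k t)) (at t within ?S)"
      by (rule has_vector_derivative_exp_commuting[OF _ t]) (use comm[OF _ t] in simp)
    moreover have "((\<lambda>t. 1 + t *\<^sub>R e) has_vector_derivative e) (at t within ?S)"
      by (auto intro!: derivative_eq_intros)
    ultimately have "(F has_vector_derivative
        exp (- g t) * e + (exp (- g t) * - (\<Sum>k. d k t)) * (1 + t *\<^sub>R e)) (at t within ?S)"
      unfolding F_def by (rule has_vector_derivative_mult)
    then show ?thesis
      using sum_d[OF t] by (simp add: mult.assoc)
  qed
  have "F 1 = F 0"
    using has_vector_derivative_zero_constant[of ?S F] dF by (metis convex_real_interval(5) atLeastAtMost_iff order_refl zero_le_one)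
  moreover have "g 0 = 0" using g_sum[of 0] by (simp add: f_def)
  ultimately have "exp (- g 1) * (1 + e) = 1" by (simp add: F_def)
  then have "exp (g 1) * (exp (- g 1) * (1 + e)) = exp (g 1)" by simp
  then have "exp (g 1) = 1 + e"
    using exp_minus_inverse[of "g 1"] by (simp add: mult.assoc[symmetric])
  moreover have "g 1 = log_series e" using g_sum[of 1] by (simp add: f_def log_series_def)
  ultimately show ?thesis by simp
qed

section \<open>Eigenvectors in invariant subspaces\<close>

lemma of_real_scale_vector: "complex_of_real r *s w = r *\<^sub>R w"
proof -
  have "complex_of_real r * w $ i = r *\<^sub>R (w $ i)" for i by (simp add: scaleR_conv_of_real)
  then show ?thesis by (simp add: vec_eq_iff)
qed

text \<open>Horner evaluation of \<open>p(Z) v\<close>.\<close>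

definition poly_act :: "complex ^ 'n ^ 'n \<Rightarrow> complex poly \<Rightarrow> complex ^ 'n \<Rightarrow> complex ^ 'n" where
  "poly_act Z p v = fold_coeffs (\<lambda>a w. a *s v + Z *v w) p 0"

lemma poly_act_0 [simp]: "poly_act Z 0 v = 0"
  by (simp add: poly_act_def)

lemma poly_act_pCons [simp]: "poly_act Z (pCons a p) v = a *s v + Z *v poly_act Z p v"
  by (cases "a = 0 \<and> p = 0") (auto simp: poly_act_def)

lemma poly_act_add: "poly_act Z (p + q) v = poly_act Z p v + poly_act Z q v"
  by (induction p q rule: poly_induct2) (simp_all add: matrix_vector_right_distrib vector_sadd_rdistrib)

lemma poly_act_smult: "poly_act Z (smult c p) v = c *s poly_act Z p v"
  by (induction p) (simp_all add: vector_sadd_rdistrib vec.scale vector_add_ldistrib matrix_vector_mult_scaleR)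

lemma poly_act_mult_linear:
  "poly_act Z ([:- \<mu>, 1:] * q) v = Z *v poly_act Z q v - \<mu> *s poly_act Z q v"
proof -
  have "[:- \<mu>, 1:] * q = smult (- \<mu>) q + pCons 0 q" by simp
  then show ?thesis by (simp only: poly_act_add poly_act_smult poly_act_pCons) simp
qed

locale invariant_subspace =
  fixes Z :: "complex ^ 'n ^ 'n" and S :: "(complex ^ 'n) set"
  assumes zero_mem: "0 \<in> S"
    and add_mem: "v \<in> S \<Longrightarrow> w \<in> S \<Longrightarrow> v + w \<in> S"
    and scale_mem: "v \<in> S \<Longrightarrow> c *s v \<in> S"
    and invariant: "v \<in> S \<Longrightarrow> Z *v v \<in> S"
begin

lemma poly_act_mem: "v \<in> S \<Longrightarrow> poly_act Z p v \<in> S"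
  by (induction p) (auto intro: zero_mem add_mem scale_mem invariant)

text \<open>Splitting off a root \<open>\<mu>\<close>, \<open>p = (X - \<mu>) q\<close>: either \<open>q(Z) v\<close> is an eigenvector for \<open>\<mu>\<close>, or \<open>q\<close> is an
annihilating polynomial of smaller degree.\<close>

lemma eigenvector_if_annihilated:
  assumes "v \<in> S" "v \<noteq> 0" "p \<noteq> 0" "poly_act Z p v = 0"
  shows "\<exists>w\<in>S. \<exists>\<mu>. w \<noteq> 0 \<and> Z *v w = \<mu> *s w"
  using assms(3,4)
proof (induction "degree p" arbitrary: p rule: less_induct)
  case less
  show ?case
  proof (cases "degree p = 0")
    case True
    then obtain c where "p = [:c:]" by (rule degree_eq_zeroE)
    with less.prems assms(2) have False by (auto simp: vector_mul_eq_0)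
    then show ?thesis ..
  next
    case False
    then have "\<not> constant (poly p)" by (simp add: constant_degree)
    then obtain \<mu> where "poly p \<mu> = 0" using fundamental_theorem_of_algebra by blast
    then obtain q where q: "p = [:- \<mu>, 1:] * q" by (auto simp: poly_eq_0_iff_dvd)
    show ?thesis
    proof (cases "poly_act Z q v = 0")
      case True
      have "q \<noteq> 0" using less.prems q by auto
      moreover from this have "degree q < degree p" unfolding q by (subst degree_mult_eq) auto
      ultimately show ?thesis using less.hyps True by blast
    next
      case False
      moreover have "Z *v poly_act Z q v = \<mu> *s poly_act Z q v"
        using less.prems(2) unfolding q poly_act_mult_linear by simp
      ultimately show ?thesis using poly_act_mem[OF assms(1)] by blast
    qed
  qed
qed

lemma poly_act_sum: "poly_act Z (\<Sum>i\<in>I. f i) v = (\<Sum>i\<in>I. poly_act Z (f i) v)"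
  by (induction I rule: infinite_finite_induct) (simp_all add: poly_act_add)

text \<open>The iterates \<open>Z^k v\<close> lie in a space of finite real dimension.  Either two of them coincide, or there
are infinitely many and hence a linear relation between them.\<close>

lemma exists_annihilating_poly: "\<exists>p. p \<noteq> 0 \<and> poly_act Z p v = 0"
proof (cases "inj (\<lambda>k. poly_act Z (monom 1 k) v)")
  case False
  then obtain i j where ij: "i \<noteq> j" "poly_act Z (monom 1 i) v = poly_act Z (monom 1 j) v"
    by (auto simp: inj_def)
  have "monom 1 i + smult (- 1) (monom 1 j) \<noteq> (0 :: complex poly)"
    using ij(1) by (metis (no_types) add.right_neutral coeff_0 coeff_add coeff_monom coeff_smult mult_zero_right zero_neq_one)
  moreover have "poly_act Z (monom 1 i + smult (- 1) (monom 1 j)) v = 0"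
    unfolding poly_act_add poly_act_smult ij(2) by simp
  ultimately show ?thesis by blast
next
  case True
  let ?f = "\<lambda>k. poly_act Z (monom 1 k) v"
  have "infinite (range ?f)" using True by (simp add: range_inj_infinite)
  then have "dependent (range ?f)" using independent_bound by blast
  then obtain T u where T: "finite T" "T \<subseteq> range ?f" "(\<Sum>w\<in>T. u w *\<^sub>R w) = 0" "\<exists>w\<in>T. u w \<noteq> 0"
    unfolding real_vector.dependent_explicit by blast
  then obtain I where I: "T = ?f ` I" "finite I"
    using finite_subset_image[OF T(1,2)] by blast
  have inj: "inj_on ?f I" using True by (rule inj_on_subset) simp
  define p :: "complex poly" where "p = (\<Sum>i\<in>I. smult (of_real (u (?f i))) (monom 1 i))"
  have "poly_act Z p v = (\<Sum>i\<in>I. u (?f i) *\<^sub>R ?f i)"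
    by (simp add: p_def poly_act_sum poly_act_smult of_real_scale_vector del: smult_monom)
  also have "\<dots> = 0"
    using T(3) unfolding I(1) by (simp add: sum.reindex[OF inj] o_def)
  finally have "poly_act Z p v = 0" .
  moreover obtain i where i: "i \<in> I" "u (?f i) \<noteq> 0" using T(4) I by auto
  have "coeff p i = of_real (u (?f i))"
    using I(2) i(1) by (simp add: p_def coeff_sum if_distrib sum.delta cong: if_cong)
  then have "p \<noteq> 0" using i(2) by auto
  ultimately show ?thesis by blast
qed

lemma eigenvector:
  assumes "v \<in> S" "v \<noteq> 0"
  obtains w \<mu> where "w \<in> S" "w \<noteq> 0" "Z *v w = \<mu> *s w"
  using exists_annihilating_poly[of v] eigenvector_if_annihilated[OF assms] by blast

end

section \<open>The principal logarithm near the identity\<close>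

text \<open>An eigenspace of \<open>Z\<close> is invariant under every matrix that commutes with \<open>Z\<close>.\<close>

lemma common_eigenvector:
  fixes Z X :: "complex ^ 'n ^ 'n"
  assumes comm: "Z ** X = X ** Z" and w: "w \<noteq> 0" "Z *v w = \<mu> *s w"
  obtains u \<kappa> where "u \<noteq> 0" "Z *v u = \<mu> *s u" "X *v u = \<kappa> *s u"
proof -
  interpret invariant_subspace X "{v. Z *v v = \<mu> *s v}"
  proof
    show "X *v v \<in> {v. Z *v v = \<mu> *s v}" if "v \<in> {v. Z *v v = \<mu> *s v}" for v
    proof -
      have "Z *v (X *v v) = X *v (Z *v v)" by (simp add: matrix_vector_mul_assoc comm)
      with that show ?thesis by (simp add: vec.scale)
    qed
  qed (auto simp: matrix_vector_right_distrib vec.scale vector_add_ldistrib vector_smult_assoc mult.commute)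
  show thesis using eigenvector[of w] w that by auto
qed

lemma mat_scale_vector: "mat c *v v = c *s (v :: complex ^ 'n)"
  by (simp add: vec_eq_iff matrix_vector_mult_def mat_def if_distrib[of "\<lambda>x. x * _"] cong: if_cong)

lemma power_apply_eigenvector:
  assumes "Z *v v = \<mu> *s v"
  shows "endo_apply (endo_of_matrix Z ^ k) v = \<mu> ^ k *s v"
  by (induction k) (simp_all add: vec.scale assms vector_smult_assoc mult.commute)

lemma power_series_eigenvector:
  assumes v: "Z *v v = \<mu> *s v"
    and summable: "summable (\<lambda>k. c k *\<^sub>R endo_of_matrix Z ^ k)"
    and sums: "(\<lambda>k. of_real (c k) * \<mu> ^ k) sums \<nu>"
  shows "endo_apply (\<Sum>k. c k *\<^sub>R endo_of_matrix Z ^ k) v = \<nu> *s v"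
proof (rule sums_unique2)
  have "bounded_linear (\<lambda>a. a *s v)"
    by (rule linear_conv_bounded_linear[THEN iffD1])
       (auto intro!: linearI simp: vector_sadd_rdistrib vec_eq_iff)
  from bounded_linear.sums[OF this sums]
  show "(\<lambda>k. c k *\<^sub>R (\<mu> ^ k *s v)) sums (\<nu> *s v)"
    by (simp add: of_real_scale_vector[symmetric] vector_smult_assoc)
  show "(\<lambda>k. c k *\<^sub>R (\<mu> ^ k *s v)) sums endo_apply (\<Sum>k. c k *\<^sub>R endo_of_matrix Z ^ k) v"
    using bounded_linear.sums[OF endo_apply.bounded_linear_left summable_sums[OF summable], of v]
    by (simp add: power_apply_eigenvector[OF v] endo_apply.scaleR_left)
qed

lemma power_series_eigenvector_shifted:
  assumes v: "Z *v v = \<mu> *s v"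
    and summable: "summable (\<lambda>k. c k *\<^sub>R endo_of_matrix Z ^ Suc k)"
    and sums: "(\<lambda>k. of_real (c k) * \<mu> ^ Suc k) sums \<nu>"
  shows "endo_apply (\<Sum>k. c k *\<^sub>R endo_of_matrix Z ^ Suc k) v = \<nu> *s v"
proof -
  define d where "d k = (case k of 0 \<Rightarrow> 0 | Suc j \<Rightarrow> c j)" for k
  have s: "summable (\<lambda>k. d k *\<^sub>R endo_of_matrix Z ^ k)"
    by (subst summable_Suc_iff[symmetric]) (use summable in \<open>simp add: d_def\<close>)
  have "(\<lambda>k. of_real (d k) * \<mu> ^ k) sums \<nu>"
    using sums sums_Suc_iff[of "\<lambda>k. of_real (d k) * \<mu> ^ k" \<nu>] by (simp add: d_def)
  from power_series_eigenvector[OF v s this] suminf_split_head[OF s]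
  show ?thesis by (simp add: d_def)
qed

definition log_matrix :: "complex ^ 'n ^ 'n \<Rightarrow> complex ^ 'n ^ 'n" where
  "log_matrix E = (\<Sum>k. ((- 1) ^ k / real (Suc k)) *\<^sub>R mat_pow E (Suc k))"

context
  fixes A :: "complex ^ 'n ^ 'n"
  assumes A: "opnorm (A - mat 1) < 1"
begin

lemma norm_endo_of_perturbation: "norm (endo_of_matrix (A - mat 1)) < 1"
  using A by (simp add: norm_endo_of_matrix)

lemma summable_log_series:
  "summable (\<lambda>k. ((- 1) ^ k / real (Suc k)) *\<^sub>R endo_of_matrix (A - mat 1) ^ Suc k)"
  by (rule summable_bounded_power_series[OF norm_endo_of_perturbation]) (simp add: power_abs)

lemma endo_of_log_matrix: "endo_of_matrix (log_matrix (A - mat 1)) = log_series (endo_of_matrix (A - mat 1))"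
  unfolding log_matrix_def log_series_def
  by (subst endo_of_matrix_suminf) (use summable_log_series in \<open>simp_all add: endo_of_matrix_simps(4) endo_of_mat_pow\<close>)

lemma exp_log_matrix: "matrix_exp (log_matrix (A - mat 1)) = A"
  by (rule inj_endo_of_matrix)
     (simp add: endo_of_matrix_exp endo_of_log_matrix exp_log_series[OF norm_endo_of_perturbation],
      simp add: endo_of_matrix_simps)

lemma commutes_log_series:
  assumes "x * endo_of_matrix (A - mat 1) = endo_of_matrix (A - mat 1) * x"
  shows "x * log_series (endo_of_matrix (A - mat 1)) = log_series (endo_of_matrix (A - mat 1)) * x"
  unfolding log_series_def
proof (rule commutes_suminf[OF summable_log_series])
  fix k
  from power_commuting_commutes[OF assms[symmetric], of "Suc k"] show "x * ((- 1) ^ k / real (Suc k)) *\<^sub>R endo_of_matrix (A - mat 1) ^ Suc k =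
      ((- 1) ^ k / real (Suc k)) *\<^sub>R endo_of_matrix (A - mat 1) ^ Suc k * x"
    by (simp del: power_Suc)
qed

text \<open>A common eigenvector with \<open>A - I\<close> exhibits the eigenvalue as \<open>Ln (1 + \<kappa>)\<close> with \<open>\<bar>\<kappa>\<bar> < 1\<close>, and \<open>1 + \<kappa>\<close>
lies in the right half-plane.\<close>

lemma log_matrix_eigenvalue:
  assumes "matrix_eigenvalue (log_matrix (A - mat 1)) \<mu>"
  shows "\<bar>Im \<mu>\<bar> < pi"
proof -
  let ?E = "A - mat 1" and ?L = "log_matrix (A - mat 1)"
  have "endo_of_matrix (?L ** ?E) = endo_of_matrix (?E ** ?L)"
    using commutes_log_series[of "endo_of_matrix ?E"]
    by (simp add: endo_of_matrix_simps(3) endo_of_log_matrix)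
  then have "?L ** ?E = ?E ** ?L" by (rule inj_endo_of_matrix)
  then obtain u \<kappa> where u: "u \<noteq> 0" "?L *v u = \<mu> *s u" "?E *v u = \<kappa> *s u"
    using common_eigenvector assms unfolding matrix_eigenvalue_def by metis
  have scale_norm: "norm (c *s u) = cmod c * norm u" for c
    by (simp add: norm_vec_def L2_set_def norm_mult power_mult_distrib sum_distrib_left[symmetric] real_sqrt_mult)
  have "norm (?E *v u) \<le> opnorm ?E * norm u"
    using norm_endo_apply[of "endo_of_matrix ?E" u] by (simp add: norm_endo_of_matrix)
  then have "cmod \<kappa> \<le> opnorm ?E" using u(1) by (simp add: u(3) scale_norm)
  then have \<kappa>: "cmod \<kappa> < 1" using A by simp
  have "(\<lambda>k. of_real ((- 1) ^ k / real (Suc k)) * \<kappa> ^ Suc k) sums Ln (1 + \<kappa>)"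
    using Ln_series[OF \<kappa>]
      sums_Suc_iff[of "\<lambda>n. (- 1) ^ Suc n / of_nat n * \<kappa> ^ n" "Ln (1 + \<kappa>)"] by simp
  from power_series_eigenvector_shifted[OF u(3) summable_log_series this]
  have "?L *v u = Ln (1 + \<kappa>) *s u"
    by (simp only: endo_apply_matrix[symmetric] endo_of_log_matrix log_series_def)
  then have "(\<mu> - Ln (1 + \<kappa>)) *s u = 0" unfolding vector_sub_rdistrib u(2)[symmetric] by simp
  then have "\<mu> = Ln (1 + \<kappa>)" using u(1) unfolding vector_mul_eq_0 by simp
  moreover have "Re (1 + \<kappa>) > 0" using \<kappa> abs_Re_le_cmod[of \<kappa>] by simp
  moreover from this have "1 + \<kappa> \<noteq> 0" by (metis zero_complex.sel(1) less_irrefl)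
  ultimately have "\<bar>Im \<mu>\<bar> < pi / 2" using Re_Ln_pos_lt by metis
  then show ?thesis using pi_gt_zero by linarith
qed

text \<open>\<open>X\<close> commutes with its exponential \<open>A\<close>, hence with the series \<open>L\<close> in \<open>A - I\<close>, so that \<open>Z = X - L\<close> satisfies
\<open>exp Z = I\<close>.  With \<open>\<phi>\<close> the entire function \<open>(exp z - 1) / z\<close> evaluated at \<open>Z\<close>, this reads \<open>\<phi> Z = 0\<close>, and it
remains to see that \<open>\<phi>\<close> has trivial kernel.\<close>

lemma strip_logarithm_unique:
  assumes X: "matrix_exp X = A" and strip: "\<And>\<mu>. matrix_eigenvalue X \<mu> \<Longrightarrow> \<bar>Im \<mu>\<bar> < pi"
  shows "X = log_matrix (A - mat 1)"
proof -
  let ?e = "endo_of_matrix (A - mat 1)"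
  define L where "L = log_matrix (A - mat 1)"
  define Z where "Z = X - L"
  define x where "x = endo_of_matrix X"
  define l where "l = endo_of_matrix L"
  define z where "z = endo_of_matrix Z"
  define \<phi> where "\<phi> = (\<Sum>k. inverse (fact (Suc k)) *\<^sub>R z ^ k)"
  have z: "z = x - l" by (simp add: z_def x_def l_def Z_def endo_of_matrix_simps)
  have l: "l = log_series ?e" by (simp add: l_def L_def endo_of_log_matrix)
  have exp_x: "exp x = 1 + ?e"
    using X endo_of_matrix_exp[of X] by (simp add: x_def endo_of_matrix_simps)
  have "x * ?e = ?e * x"
    using exp_times_arg_commute[of x] unfolding exp_x by (simp add: algebra_simps)
  then have xl: "x * l = l * x" unfolding l by (rule commutes_log_series)
  have "exp z = exp x * exp (- l)"
    using exp_add_commuting[of x "- l"] xl by (simp add: z)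
  also have "\<dots> = 1"
    using exp_minus_inverse[of l] exp_log_series[OF norm_endo_of_perturbation] by (simp add: exp_x l)
  finally have exp_z: "exp z = 1" .
  have sum_\<phi>: "summable (\<lambda>k. inverse (fact (Suc k)) *\<^sub>R z ^ k)"
  proof (rule summable_comparison_test')
    show "summable (\<lambda>k. norm z ^ k /\<^sub>R fact k)" by (rule summable_exp_generic)
    show "norm (inverse (fact (Suc k)) *\<^sub>R z ^ k) \<le> norm z ^ k /\<^sub>R fact k" for k
    proof -
      have "norm (inverse (fact (Suc k)) *\<^sub>R z ^ k) = inverse (fact (Suc k)) * norm (z ^ k)" by simp
      also have "\<dots> \<le> inverse (fact k) * norm z ^ k"
        by (intro mult_mono norm_power_ineq le_imp_inverse_le fact_mono) auto
      finally show ?thesis by simp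
    qed
  qed
  have \<phi>_comm: "T * \<phi> = \<phi> * T" if "T * z = z * T" for T
    unfolding \<phi>_def
  proof (rule commutes_suminf[OF sum_\<phi>])
    fix k
    have "T * z ^ k = z ^ k * T"
      by (rule power_commuting_commutes[OF that[symmetric], symmetric])
    then show "T * inverse (fact (Suc k)) *\<^sub>R z ^ k = inverse (fact (Suc k)) *\<^sub>R z ^ k * T" by simp
  qed
  have "\<phi> * z = (\<Sum>k. z ^ Suc k /\<^sub>R fact (Suc k))"
    unfolding \<phi>_def by (subst suminf_mult2[OF sum_\<phi>]) (simp add: power_commutes)
  also have "\<dots> = exp z - 1"
    unfolding exp_def using suminf_split_head[OF summable_exp_generic[of z]] by simp
  finally have \<phi>z: "\<phi> * z = 0" by (simp add: exp_z)
  \<comment> \<open>The kernel of \<open>\<phi>\<close> is invariant under \<open>Z\<close>, so if it were nontrivial it would contain an eigenvector of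
      \<open>Z\<close>, with an eigenvalue \<open>\<mu>\<close> such that \<open>exp \<mu> = 1\<close>.\<close>
  have ker: "v = 0" if v: "endo_apply \<phi> v = 0" for v
  proof (rule ccontr)
    assume "v \<noteq> 0"
    interpret invariant_subspace Z "{v. endo_apply \<phi> v = 0}"
    proof
      fix v assume v: "v \<in> {v. endo_apply \<phi> v = 0}"
      have "endo_apply \<phi> (Z *v v) = endo_apply (\<phi> * z) v" by (simp add: z_def)
      then show "Z *v v \<in> {v. endo_apply \<phi> v = 0}" by (simp add: \<phi>z endo_apply.zero_left)
      fix c
      have "endo_of_matrix (mat c) * z = z * endo_of_matrix (mat c)"
        by (rule endo_eqI) (simp add: z_def mat_scale_vector vec.scale)
      from \<phi>_comm[OF this] have "endo_apply (\<phi> * endo_of_matrix (mat c)) v = c *s endo_apply \<phi> v"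
        by (metis endo_apply_matrix endo_apply_mult mat_scale_vector)
      then show "c *s v \<in> {v. endo_apply \<phi> v = 0}" using v by (simp add: mat_scale_vector)
    qed (auto simp: endo_apply.add_right endo_apply.zero_right)
    obtain w \<mu> where w: "endo_apply \<phi> w = 0" "w \<noteq> 0" "Z *v w = \<mu> *s w"
      using eigenvector[of v] v \<open>v \<noteq> 0\<close> by auto
    have exp_\<mu>: "exp \<mu> = 1"
    proof -
      have "(\<lambda>k. of_real (inverse (fact k)) * \<mu> ^ k) sums exp \<mu>"
        using exp_converges[of \<mu>] by (simp add: scaleR_conv_of_real)
      from power_series_eigenvector[OF w(3) _ this]
      have "endo_apply (exp z) w = exp \<mu> *s w"
        using summable_exp_generic[of z] by (simp add: z_def exp_def)
      then have "(exp \<mu> - 1) *s w = 0" by (simp add: exp_z vector_sub_rdistrib)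
      then show ?thesis using w(2) unfolding vector_mul_eq_0 by simp
    qed
    have "endo_of_matrix (Z ** X) = endo_of_matrix (X ** Z)"
      unfolding endo_of_matrix_simps(3) z_def[symmetric] x_def[symmetric] z
      using xl by (simp add: algebra_simps)
    then have "Z ** X = X ** Z" by (rule inj_endo_of_matrix)
    then obtain u \<kappa> where u: "u \<noteq> 0" "Z *v u = \<mu> *s u" "X *v u = \<kappa> *s u"
      using common_eigenvector w(2,3) by metis
    have "L *v u = X *v u - Z *v u" by (simp add: Z_def matrix_vector_mult_diff_rdistrib)
    then have Lu: "L *v u = (\<kappa> - \<mu>) *s u" by (simp add: u vector_sub_rdistrib)
    \<comment> \<open>\<open>\<mu>\<close> is a difference of eigenvalues of \<open>X\<close> and \<open>L\<close>, so \<open>\<bar>Im \<mu>\<bar> < 2 pi\<close>, which leaves only \<open>\<mu> = 0\<close>.\<close>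
    have "\<bar>Im \<kappa>\<bar> < pi" using strip u unfolding matrix_eigenvalue_def by blast
    moreover have "\<bar>Im (\<kappa> - \<mu>)\<bar> < pi"
      using log_matrix_eigenvalue Lu u(1) unfolding matrix_eigenvalue_def L_def by blast
    ultimately have small: "\<bar>Im \<mu>\<bar> < 2 * pi" by simp
    obtain n :: int where n: "Re \<mu> = 0" "Im \<mu> = of_int (2 * n) * pi"
      using exp_\<mu> unfolding exp_eq_1 by blast
    have "n = 0"
    proof (rule ccontr)
      assume "n \<noteq> 0"
      then have "1 \<le> \<bar>real_of_int n\<bar>" by linarith
      then have "1 * (2 * pi) \<le> \<bar>real_of_int n\<bar> * (2 * pi)" by (intro mult_right_mono) auto
      moreover have "\<bar>Im \<mu>\<bar> = \<bar>real_of_int n\<bar> * (2 * pi)" unfolding n(2) by (simp add: abs_mult)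
      ultimately show False using small by simp
    qed
    then have "\<mu> = 0" using n by (simp add: complex_eq_iff)
    \<comment> \<open>But at the eigenvalue 0 the function takes the value 1.\<close>
    have "(\<lambda>k. of_real (inverse (fact (Suc k))) * \<mu> ^ k) sums (of_real (inverse (fact (Suc 0))) :: complex)"
      unfolding \<open>\<mu> = 0\<close> by (rule powser_sums_zero)
    from power_series_eigenvector[OF w(3) _ this] sum_\<phi>
    have "endo_apply \<phi> w = w" by (simp add: \<phi>_def z_def)
    with w show False by simp
  qed
  have "z = 0"
  proof (rule endo_eqI)
    fix v
    have "endo_apply \<phi> (endo_apply z v) = endo_apply (\<phi> * z) v" by simp
    also have "\<dots> = 0" by (simp add: \<phi>z endo_apply.zero_left)
    finally have "endo_apply z v = 0" by (rule ker)
    then show "endo_apply z v = endo_apply 0 v" by (simp only: endo_apply.zero_left)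
  qed
  then have "x = l" using z by simp
  then show ?thesis unfolding x_def l_def L_def by (rule inj_endo_of_matrix)
qed

lemma principal_log_eq: "principal_log A = log_matrix (A - mat 1)"
  unfolding principal_log_def
  using exp_log_matrix log_matrix_eigenvalue strip_logarithm_unique by (intro the_equality) blast+

lemma endo_of_principal_log: "endo_of_matrix (principal_log A) = log_series (endo_of_matrix (A - mat 1))"
  by (simp add: principal_log_eq endo_of_log_matrix)

end

section \<open>Gauss-Legendre quadrature of monomials\<close>

definition poly_integral :: "real poly \<Rightarrow> real" where
  "poly_integral p = integral {-1..1} (poly p)"

lemma poly_integrable: "poly p integrable_on {-1..1::real}"
  by (intro integrable_continuous_real continuous_intros)

lemma poly_integral_add: "poly_integral (p + q) = poly_integral p + poly_integral q"
  unfolding poly_integral_def poly_add by (rule integral_add[OF poly_integrable poly_integrable])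

lemma poly_integral_smult: "poly_integral (smult c p) = c * poly_integral p"
  unfolding poly_integral_def poly_smult by simp

lemma poly_integral_minus: "poly_integral (- p) = - poly_integral p"
  using poly_integral_smult[of "- 1" p] by simp

lemma poly_integral_0 [simp]: "poly_integral 0 = 0"
  using poly_integral_smult[of 0 0] by simp

lemma poly_integral_sum: "poly_integral (\<Sum>i\<in>I. p i) = (\<Sum>i\<in>I. poly_integral (p i))"
  by (induction I rule: infinite_finite_induct) (simp_all add: poly_integral_add)

lemma poly_integral_pderiv: "poly_integral (pderiv p) = poly p 1 - poly p (- 1)"
proof -
  have "(poly (pderiv p) has_integral poly p 1 - poly p (- 1)) {-1..1}"
    by (rule fundamental_theorem_of_calculus)
       (auto simp flip: has_real_derivative_iff_has_vector_derivative intro: DERIV_subset poly_DERIV)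
  then show ?thesis unfolding poly_integral_def by (rule integral_unique)
qed

lemma poly_integral_nonneg:
  assumes "\<And>x. x \<in> {-1..1} \<Longrightarrow> poly p x \<ge> 0"
  shows "poly_integral p \<ge> 0"
  unfolding poly_integral_def using assms by (intro integral_nonneg poly_integrable) auto

lemma poly_integral_pos:
  assumes nonneg: "\<And>x. x \<in> {-1..1} \<Longrightarrow> poly p x \<ge> 0" and "p \<noteq> 0"
  shows "poly_integral p > 0"
proof -
  have "poly_integral p \<noteq> 0"
  proof
    assume "poly_integral p = 0"
    then have "\<forall>x\<in>{-1..1}. poly p x = 0"
      unfolding poly_integral_def
      by (subst (asm) integral_eq_0_iff) (auto intro!: continuous_intros nonneg)
    then have "{-1..1} \<subseteq> {x. poly p x = 0}" by auto
    then have "finite {-1..1::real}" using poly_roots_finite[OF \<open>p \<noteq> 0\<close>] finite_subset by blast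
    then show False using infinite_Icc[of "-1::real" 1] by simp
  qed
  then show ?thesis using poly_integral_nonneg[OF nonneg] by force
qed

lemma poly_integral_by_parts:
  assumes "poly u 1 = 0" "poly u (- 1) = 0"
  shows "poly_integral (pderiv u * q) = - poly_integral (u * pderiv q)"
  using poly_integral_pderiv[of "u * q"] assms
  by (simp add: pderiv_mult poly_integral_add mult.commute add_eq_0_iff)

lemma poly_integral_iterated_parts:
  assumes "\<And>j. j < k \<Longrightarrow> poly ((pderiv ^^ j) u) 1 = 0 \<and> poly ((pderiv ^^ j) u) (- 1) = 0"
  shows "poly_integral ((pderiv ^^ k) u * q) = (- 1) ^ k * poly_integral (u * (pderiv ^^ k) q)"
  using assms
proof (induction k arbitrary: q)
  case (Suc k)
  have "poly_integral ((pderiv ^^ Suc k) u * q) = - poly_integral ((pderiv ^^ k) u * pderiv q)"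
    using Suc.prems by (simp add: poly_integral_by_parts)
  also have "\<dots> = - ((- 1) ^ k * poly_integral (u * (pderiv ^^ k) (pderiv q)))"
    using Suc by simp
  finally show ?case by (simp add: funpow_swap1)
qed simp

lemma power_dvd_pderiv:
  fixes p :: "real poly"
  assumes "[:- a, 1:] ^ Suc m dvd p"
  shows "[:- a, 1:] ^ m dvd pderiv p"
proof -
  obtain r where "p = [:- a, 1:] ^ Suc m * r" using assms by (elim dvdE)
  then have "pderiv p = [:- a, 1:] ^ m * ([:- a, 1:] * pderiv r + smult (of_nat (Suc m)) r)"
    by (simp add: pderiv_mult pderiv_power_Suc pderiv_pCons algebra_simps del: power_Suc)
       (simp add: algebra_simps)
  then show ?thesis by simp
qed

lemma power_dvd_higher_pderiv:
  fixes p :: "real poly"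
  assumes "[:- a, 1:] ^ n dvd p" "j \<le> n"
  shows "[:- a, 1:] ^ (n - j) dvd (pderiv ^^ j) p"
  using assms(2)
proof (induction j)
  case (Suc j)
  then have "[:- a, 1:] ^ Suc (n - Suc j) dvd (pderiv ^^ j) p" by (simp add: Suc_diff_Suc)
  then show ?case by (simp only: funpow.simps o_apply power_dvd_pderiv)
qed (simp add: assms)

lemma higher_pderiv_eq_0:
  fixes q :: "real poly"
  shows "degree q < n \<Longrightarrow> (pderiv ^^ n) q = 0"
proof (induction n arbitrary: q)
  case (Suc n)
  show ?case
  proof (cases "degree q = 0")
    case True
    then have "pderiv q = 0" by (simp add: pderiv_eq_0_iff)
    moreover have "(pderiv ^^ n) 0 = (0 :: real poly)" by (induction n) auto
    ultimately show ?thesis by (simp add: funpow_swap1)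
  next
    case False
    then have "degree (pderiv q) < n" using Suc.prems by (simp add: degree_pderiv)
    then show ?thesis using Suc.IH by (simp add: funpow_swap1)
  qed
qed simp

lemma degree_higher_pderiv: "degree ((pderiv ^^ n) p) = degree (p :: real poly) - n"
  by (induction n) (simp_all add: degree_pderiv)

lemma degree_legendre_poly: "degree (legendre_poly n) = n"
proof -
  have "degree ([:- 1, 0, 1 :: real:] ^ n) = n * 2" by (simp add: degree_power_eq)
  then show ?thesis by (simp add: legendre_poly_def degree_higher_pderiv)
qed

text \<open>By Rodrigues' formula: \<open>(x\<^sup>2 - 1)^n\<close> vanishes to order \<open>n\<close> at both end points, so \<open>n\<close> integrations by parts
produce no boundary terms and leave the \<open>n\<close>-th derivative of \<open>q\<close>, which is 0.\<close>

lemma legendre_poly_orthogonal: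
  assumes "degree q < n"
  shows "poly_integral (legendre_poly n * q) = 0"
proof -
  let ?u = "[:- 1, 0, 1 :: real:] ^ n"
  have u: "?u = [:- 1, 1:] ^ n * [:- (- 1), 1:] ^ n"
    by (simp flip: power_mult_distrib)
  have "poly ((pderiv ^^ j) ?u) a = 0" if "j < n" "a = 1 \<or> a = - 1" for j a
  proof -
    have "[:- a, 1:] ^ n dvd ?u" unfolding u using that(2) by auto
    then have "[:- a, 1:] ^ (n - j) dvd (pderiv ^^ j) ?u"
      using that(1) by (intro power_dvd_higher_pderiv) auto
    moreover have "[:- a, 1:] dvd [:- a, 1:] ^ (n - j)" using that(1) by (intro dvd_power) auto
    ultimately show ?thesis unfolding poly_eq_0_iff_dvd by (rule dvd_trans[rotated])
  qed
  then have "poly_integral ((pderiv ^^ n) ?u * q) = 0"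
    by (subst poly_integral_iterated_parts) (auto simp: higher_pderiv_eq_0[OF assms])
  then show ?thesis by (simp add: legendre_poly_def poly_integral_smult)
qed

lemma prod_linear_factors_dvd:
  fixes p :: "real poly"
  assumes "finite J" "inj_on t J" "\<And>j. j \<in> J \<Longrightarrow> poly p (t j) = 0"
  shows "(\<Prod>j\<in>J. [:- t j, 1:]) dvd p"
  using assms
proof (induction J rule: finite_induct)
  case (insert i J)
  then obtain q where q: "p = (\<Prod>j\<in>J. [:- t j, 1:]) * q" by (auto elim: dvdE)
  have "poly (\<Prod>j\<in>J. [:- t j, 1:]) (t i) \<noteq> 0"
    using insert.hyps insert.prems(1) by (auto simp: poly_prod)
  then have "poly q (t i) = 0" using insert.prems(2)[of i] q by simp
  then have "[:- t i, 1:] dvd q" by (simp add: poly_eq_0_iff_dvd)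
  then have "[:- t i, 1:] * (\<Prod>j\<in>J. [:- t j, 1:]) dvd q * (\<Prod>j\<in>J. [:- t j, 1:])"
    by (rule mult_dvd_mono) (rule dvd_refl)
  then show ?case using insert.hyps q by (simp add: mult.commute[of _ q] del: mult_pCons_left)
qed simp

lemma degree_prod_linear_factors: "degree (\<Prod>j\<in>J. [:- t j, 1 :: real:]) = card J"
  by (subst degree_prod_eq_sum_degree) auto

definition nonneg_coeffs :: "real poly \<Rightarrow> bool" where
  "nonneg_coeffs p \<longleftrightarrow> (\<forall>i. coeff p i \<ge> 0)"

lemma nonneg_coeffs_pCons [simp]: "nonneg_coeffs (pCons a p) \<longleftrightarrow> a \<ge> 0 \<and> nonneg_coeffs p"
  by (force simp: nonneg_coeffs_def coeff_pCons split: nat.splits)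

lemma poly_nonneg: "nonneg_coeffs p \<Longrightarrow> x \<ge> 0 \<Longrightarrow> poly p x \<ge> 0"
  by (induction p) auto

lemma nonneg_coeffs_synthetic_div:
  "nonneg_coeffs p \<Longrightarrow> a \<ge> 0 \<Longrightarrow> nonneg_coeffs (synthetic_div p a)"
proof (induction p)
  case 0
  then show ?case by (simp add: nonneg_coeffs_def)
next
  case (pCons c p)
  then show ?case by (simp add: poly_nonneg)
qed

text \<open>An algebraic form of the fact that the quadrature error is a positive multiple of a derivative of order \<open>2M\<close>, which is
nonnegative for monomials.  Horner division by \<open>x - a\<close> with \<open>a \<ge> 0\<close> keeps
coefficients nonnegative, hence so does division by the square of the node polynomial, carried
out one linear factor at a time.\<close>

lemma division_by_squares_nonneg:
  assumes "finite J" "nonneg_coeffs p" "\<And>j. j \<in> J \<Longrightarrow> \<tau> j \<ge> 0"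
  shows "\<exists>Q R. p = (\<Prod>j\<in>J. [:- \<tau> j, 1:] ^ 2) * Q + R \<and> nonneg_coeffs Q \<and> (R = 0 \<or> degree R < 2 * card J)"
  using assms(1,3)
proof (induction J rule: finite_induct)
  case empty
  then show ?case using assms(2) by (intro exI[of _ p] exI[of _ 0]) auto
next
  case (insert i J)
  let ?W = "\<Prod>j\<in>J. [:- \<tau> j, 1:] ^ 2" and ?l = "[:- \<tau> i, 1:]"
  obtain Q R where QR: "p = ?W * Q + R" "nonneg_coeffs Q" "R = 0 \<or> degree R < 2 * card J"
    using insert by auto
  define Q1 where "Q1 = synthetic_div Q (\<tau> i)"
  define Q2 where "Q2 = synthetic_div Q1 (\<tau> i)"
  define S where "S = ?l * [:poly Q1 (\<tau> i):] + [:poly Q (\<tau> i):]"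
  have Q1: "nonneg_coeffs Q1" and Q2: "nonneg_coeffs Q2"
    using QR(2) insert.prems by (auto simp: Q1_def Q2_def nonneg_coeffs_synthetic_div)
  have "Q = ?l * Q1 + [:poly Q (\<tau> i):]" "Q1 = ?l * Q2 + [:poly Q1 (\<tau> i):]"
    unfolding Q1_def Q2_def by (rule synthetic_div_correct'[symmetric])+
  then have "Q = ?l ^ 2 * Q2 + S"
    unfolding S_def by (metis (no_types, lifting) add.assoc distrib_left mult.assoc power2_eq_square)
  then have "p = (?l ^ 2 * ?W) * Q2 + (?W * S + R)"
    by (subst QR(1)) (simp add: algebra_simps)
  moreover have "degree (?W * S + R) < 2 * card (insert i J)"
  proof -
    have "degree ?W = 2 * card J"
      by (subst degree_prod_eq_sum_degree) (auto simp: degree_power_eq)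
    moreover have "degree S \<le> 1" unfolding S_def by (intro degree_add_le order.trans[OF degree_mult_le]) auto
    ultimately have "degree (?W * S) \<le> 2 * card J + 1"
      using degree_mult_le[of ?W S] by linarith
    then have "degree (?W * S + R) \<le> 2 * card J + 1" using QR(3) by (intro degree_add_le) auto
    then show ?thesis using insert.hyps by simp
  qed
  ultimately show ?case using Q2 insert.hyps by (intro exI[of _ Q2] exI[of _ "?W * S + R"]) simp
qed

context
  fixes t s :: "'m::finite \<Rightarrow> real"
  assumes gauss: "gauss_legendre t s"
begin

definition node_poly :: "real poly" where "node_poly = (\<Prod>j\<in>UNIV. [:- t j, 1:])"

lemma inj_nodes: "inj t"
  using gauss by (simp add: gauss_legendre_def bij_betw_def)

lemma degree_node_poly: "degree node_poly = CARD('m)"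
  by (simp add: node_poly_def degree_prod_linear_factors)

lemma poly_node_poly [simp]: "poly node_poly (t j) = 0"
  by (auto simp: node_poly_def poly_prod)

lemma legendre_poly_eq_node_poly: "\<exists>c. c \<noteq> 0 \<and> legendre_poly CARD('m) = smult c node_poly"
proof -
  have "poly (legendre_poly CARD('m)) (t j) = 0" for j
    using gauss by (auto simp: gauss_legendre_def bij_betw_def)
  then have "node_poly dvd legendre_poly CARD('m)"
    unfolding node_poly_def using inj_nodes by (intro prod_linear_factors_dvd) auto
  then obtain q where q: "legendre_poly CARD('m) = node_poly * q" by (elim dvdE)
  have nz: "legendre_poly CARD('m) \<noteq> 0" using degree_legendre_poly[of "CARD('m)"] by auto
  then have "CARD('m) = CARD('m) + degree q"
    using q degree_legendre_poly[of "CARD('m)"] degree_node_poly by (metis degree_mult_eq mult_eq_0_iff)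
  then obtain c where "q = [:c:]" using degree_eq_zeroE by (metis add_cancel_right_right)
  then show ?thesis using q nz by (intro exI[of _ c]) auto
qed

lemma node_poly_orthogonal: "degree q < CARD('m) \<Longrightarrow> poly_integral (node_poly * q) = 0"
  using legendre_poly_eq_node_poly legendre_poly_orthogonal[of q "CARD('m)"]
  by (auto simp: poly_integral_smult)

text \<open>If a node \<open>t j\<close> were outside the open interval, then the node polynomial times its cofactor \<open>V\<close> would be
\<open>(x - t j) V\<^sup>2\<close>, of constant sign on \<open>[-1, 1]\<close>, although orthogonality makes its integral 0.\<close>

lemma node_in_interval: "\<bar>t j\<bar> < 1"
proof (rule ccontr)
  assume "\<not> \<bar>t j\<bar> < 1"
  then have tj: "t j \<ge> 1 \<or> t j \<le> - 1" by auto
  define V where "V = (\<Prod>k\<in>UNIV - {j}. [:- t k, 1:])"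
  have W: "node_poly = [:- t j, 1:] * V"
    unfolding node_poly_def V_def by (rule prod.remove) auto
  have "V \<noteq> 0" by (simp add: V_def)
  have "degree V < CARD('m)" by (simp add: V_def degree_prod_linear_factors card_gt_0_iff)
  then have zero: "poly_integral (node_poly * V) = 0" by (rule node_poly_orthogonal)
  have val: "poly (node_poly * V) x = (x - t j) * (poly V x)\<^sup>2" for x
    by (simp add: W power2_eq_square algebra_simps)
  have nz: "node_poly * V \<noteq> 0" using \<open>V \<noteq> 0\<close> by (simp add: W del: mult_pCons_left)
  from tj show False
  proof
    assume "t j \<ge> 1"
    then have "0 < poly_integral (- (node_poly * V))"
      using nz by (intro poly_integral_pos) (auto simp: val mult_nonpos_nonneg simp del: poly_mult)
    then show False using zero by (simp add: poly_integral_minus)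
  next
    assume "t j \<le> - 1"
    then have "0 < poly_integral (node_poly * V)"
      using nz by (intro poly_integral_pos) (auto simp: val simp del: poly_mult)
    then show False using zero by simp
  qed
qed

definition lagrange_poly :: "'m \<Rightarrow> real poly" where
  "lagrange_poly j = (\<Prod>k\<in>UNIV - {j}. smult (1 / (t j - t k)) [:- t k, 1:])"

lemma weight_eq: "s j = poly_integral (lagrange_poly j)"
proof -
  have "poly (lagrange_poly j) = (\<lambda>x. \<Prod>k\<in>UNIV - {j}. (x - t k) / (t j - t k))"
    by (rule ext) (unfold lagrange_poly_def poly_prod, intro prod.cong refl, simp add: diff_divide_distrib)
  moreover have "s j = integral {-1..1} (\<lambda>x. \<Prod>k\<in>UNIV - {j}. (x - t k) / (t j - t k))"
    using gauss by (simp add: gauss_legendre_def)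
  ultimately show ?thesis unfolding poly_integral_def by (simp only:)
qed

lemma lagrange_poly_node: "poly (lagrange_poly j) (t k) = (if k = j then 1 else 0)"
proof (cases "k = j")
  case True
  have "poly (lagrange_poly j) (t j) = (\<Prod>k\<in>UNIV - {j}. 1)"
    unfolding lagrange_poly_def poly_prod
  proof (intro prod.cong refl)
    fix k assume "k \<in> UNIV - {j}"
    then have "t j \<noteq> t k" using inj_nodes by (auto dest: injD)
    then show "poly (smult (1 / (t j - t k)) [:- t k, 1:]) (t j) = 1"
      by (simp add: diff_divide_distrib[symmetric])
  qed
  then show ?thesis using True by simp
next
  case False
  then show ?thesis unfolding lagrange_poly_def poly_prod by (auto intro!: bexI[of _ k])
qed

lemma degree_lagrange_poly: "degree (lagrange_poly j) < CARD('m)"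
proof -
  have "degree (lagrange_poly j) \<le> (\<Sum>k\<in>UNIV - {j}. degree (smult (1 / (t j - t k)) [:- t k, 1:]))"
    unfolding lagrange_poly_def by (rule degree_prod_sum_le[THEN order.trans]) (auto simp: o_def)
  also have "\<dots> \<le> (\<Sum>k\<in>UNIV - {j}. 1)" by (intro sum_mono) auto
  also have "\<dots> < CARD('m)" by (simp add: card_gt_0_iff)
  finally show ?thesis .
qed

lemma lagrange_interpolation:
  assumes "degree r < CARD('m)"
  shows "r = (\<Sum>j\<in>UNIV. smult (poly r (t j)) (lagrange_poly j))" (is "r = ?p")
proof (rule ccontr)
  assume ne: "r \<noteq> ?p"
  have vanish: "poly (r - ?p) (t k) = 0" for k
    by (simp add: poly_sum lagrange_poly_node if_distrib sum.delta cong: if_cong)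
  have "node_poly dvd r - ?p"
    unfolding node_poly_def by (rule prod_linear_factors_dvd[OF finite inj_nodes vanish])
  then have "CARD('m) \<le> degree (r - ?p)"
    using ne dvd_imp_degree_le[of node_poly "r - ?p"] by (simp add: degree_node_poly)
  moreover have "degree ?p < CARD('m)"
    by (intro degree_sum_less) (auto simp: degree_lagrange_poly)
  then have "degree (r - ?p) < CARD('m)" using assms by (intro degree_diff_less)
  ultimately show False by simp
qed

text \<open>Division by the node polynomial: the quotient part integrates to 0 by orthogonality and vanishes at
the nodes, and the remainder is reproduced by Lagrange interpolation.\<close>

lemma gauss_exact:
  assumes p: "degree p < 2 * CARD('m)"
  shows "poly_integral p = (\<Sum>j\<in>UNIV. s j * poly p (t j))"
proof -
  define q where "q = p div node_poly"
  define r where "r = p mod node_poly"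
  have pqr: "p = node_poly * q + r" by (simp add: q_def r_def)
  have nz: "node_poly \<noteq> 0" using degree_node_poly by auto
  have r: "degree r < CARD('m)"
    using degree_mod_less'[of node_poly p] nz degree_node_poly unfolding r_def
    by (cases "p mod node_poly = 0") auto
  have q: "degree q < CARD('m)"
  proof (cases "q = 0")
    case False
    have "degree (node_poly * q) = degree (p - r)" using pqr by simp
    also have "\<dots> < 2 * CARD('m)" using p r by (intro degree_diff_less) auto
    finally show ?thesis using False nz by (simp add: degree_mult_eq degree_node_poly)
  qed simp
  have "poly_integral p = poly_integral r"
    by (subst pqr) (simp add: poly_integral_add node_poly_orthogonal[OF q])
  also have "\<dots> = (\<Sum>j\<in>UNIV. s j * poly r (t j))"
    by (subst lagrange_interpolation[OF r])
       (simp add: poly_integral_sum poly_integral_smult weight_eq mult.commute)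
  also have "\<dots> = (\<Sum>j\<in>UNIV. s j * poly p (t j))"
    by (intro sum.cong refl) (simp add: pqr)
  finally show ?thesis .
qed

lemma unit_node_bounds: "0 < unit_nodes t j" "unit_nodes t j < 1"
  using node_in_interval[of j] by (auto simp: unit_nodes_def)

lemma poly_integral_unit_power: "poly_integral ([:1/2, 1/2:] ^ m) = 2 / real (Suc m)"
proof -
  let ?u = "[:1/2, 1/2 :: real:]"
  have "pderiv ?u = [:1/2:]" by (simp add: pderiv_pCons)
  then have du: "?u ^ m * pderiv ?u = smult (1/2) (?u ^ m)" by simp
  have c: "2 / real (Suc m) * (real (Suc m) * (1 / 2)) = 1" by (simp del: of_nat_Suc)
  have "pderiv (smult (2 / real (Suc m)) ([:1/2, 1/2:] ^ Suc m)) = [:1/2, 1/2:] ^ m"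
    by (simp only: pderiv_smult pderiv_power_Suc mult_smult_left du smult_smult mult.assoc c smult_1_left)
  then show ?thesis
    using poly_integral_pderiv[of "smult (2 / real (Suc m)) ([:1/2, 1/2:] ^ Suc m)"] by (simp add: poly_power)
qed

text \<open>The affine map \<open>x \<mapsto> 1/2 + x/2\<close> carries \<open>[-1, 1]\<close> to \<open>[0, 1]\<close> and the nodes \<open>t j\<close> to the unit nodes; the
monomials on \<open>[0, 1]\<close> become the powers of the polynomial \<open>[:1/2, 1/2:]\<close>.\<close>

lemma unit_moment_sum:
  "(\<Sum>j\<in>UNIV. s j * poly ([:1/2, 1/2:] ^ m) (t j)) = 2 * (\<Sum>j\<in>UNIV. unit_weights s j * unit_nodes t j ^ m)"
  by (simp add: sum_distrib_left unit_weights_def unit_nodes_def add.commute)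

lemma unit_moment_exact:
  assumes "m < 2 * CARD('m)"
  shows "(\<Sum>j\<in>UNIV. unit_weights s j * unit_nodes t j ^ m) = 1 / real (Suc m)"
proof -
  have "degree ([:1/2, 1/2 :: real:] ^ m) < 2 * CARD('m)" using assms by (simp add: degree_power_eq)
  from gauss_exact[OF this] show ?thesis
    unfolding unit_moment_sum poly_integral_unit_power by (simp add: field_simps)
qed

text \<open>Dividing \<open>u^m\<close> by the squared node polynomial leaves a remainder that is integrated exactly and has the
same values at the nodes.  The quotient has nonnegative coefficients, so the part that the quadrature
does not see is nonnegative on \<open>[0, 1]\<close>.\<close>

lemma unit_moment_le: "(\<Sum>j\<in>UNIV. unit_weights s j * unit_nodes t j ^ m) \<le> 1 / real (Suc m)"
proof -
  let ?u = "[:1/2, 1/2 :: real:]" and ?P = "\<Prod>j\<in>UNIV. [:- unit_nodes t j, 1:] ^ 2"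
  have "nonneg_coeffs (monom 1 m)" by (simp add: nonneg_coeffs_def)
  then obtain Q R where QR: "monom 1 m = ?P * Q + R" "nonneg_coeffs Q" "R = 0 \<or> degree R < 2 * CARD('m)"
    using division_by_squares_nonneg[of UNIV "monom 1 m" "unit_nodes t"] unit_node_bounds
    by (auto simp: less_imp_le)
  have R: "degree R < 2 * CARD('m)" using QR(3) by (auto simp: card_gt_0_iff)
  have split: "?u ^ m = pcompose (?P * Q) ?u + pcompose R ?u"
    using arg_cong[OF QR(1), of "\<lambda>p. pcompose p ?u"]
    by (simp add: pcompose_add) (simp add: poly_eq_poly_eq_iff[symmetric] fun_eq_iff poly_pcompose poly_monom poly_power)
  have u_node: "poly ?u (t j) = unit_nodes t j" for j by (simp add: unit_nodes_def)
  have P_node: "poly ?P (unit_nodes t j) = 0" for j by (auto simp: poly_prod)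
  have "0 \<le> poly_integral (pcompose (?P * Q) ?u)"
  proof (rule poly_integral_nonneg)
    fix x :: real assume "x \<in> {-1..1}"
    then have "0 \<le> poly Q (poly ?u x)" by (intro poly_nonneg[OF QR(2)]) auto
    moreover have "0 \<le> poly ?P (poly ?u x)" unfolding poly_prod by (intro prod_nonneg) (simp add: poly_power)
    ultimately show "0 \<le> poly (pcompose (?P * Q) ?u) x" unfolding poly_pcompose poly_mult by (rule mult_nonneg_nonneg[rotated])
  qed
  moreover have "poly_integral (pcompose R ?u) = (\<Sum>j\<in>UNIV. s j * poly (?u ^ m) (t j))"
  proof -
    have "degree (pcompose R ?u) < 2 * CARD('m)" using R by (simp add: degree_pcompose)
    then have "poly_integral (pcompose R ?u) = (\<Sum>j\<in>UNIV. s j * poly (pcompose R ?u) (t j))" by (rule gauss_exact)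
    also have "\<dots> = (\<Sum>j\<in>UNIV. s j * poly (?u ^ m) (t j))"
      unfolding split poly_add poly_pcompose poly_mult u_node P_node by simp
    finally show ?thesis .
  qed
  ultimately have "(\<Sum>j\<in>UNIV. s j * poly (?u ^ m) (t j)) \<le> poly_integral (?u ^ m)"
    using split poly_integral_add by simp
  then show ?thesis
    unfolding unit_moment_sum poly_integral_unit_power by (simp add: field_simps)
qed

end

section \<open>Pade approximants and the quadrature rational function\<close>

lemma poly_bigo_eq_0:
  fixes p :: "real poly"
  assumes O: "poly p \<in> O[at 0](\<lambda>x. x ^ (n + 1))" and deg: "degree p \<le> n"
  shows "p = 0"
proof (rule ccontr)
  assume p: "p \<noteq> 0"
  obtain q where q: "p = [:- 0, 1:] ^ order 0 p * q" "\<not> [:- 0, 1:] dvd q"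
    using order_decomp[OF p] by blast
  have q0: "poly q 0 \<noteq> 0" using q(2) unfolding poly_eq_0_iff_dvd .
  have ord: "order 0 p \<le> n" using order_degree[OF p, of 0] deg by simp
  obtain c where c: "\<forall>\<^sub>F x in at 0. norm (poly p x) \<le> c * norm (x ^ (n + 1))"
    using O by (elim landau_o.bigE)
  have "\<forall>\<^sub>F x in at (0::real). x \<noteq> 0" by (rule eventually_neq_at_within)
  with c have ev: "\<forall>\<^sub>F x in at 0. \<bar>poly q x\<bar> \<le> c * \<bar>x\<bar> ^ (n + 1 - order 0 p)"
  proof eventually_elim
    case (elim x)
    let ?r = "order 0 p"
    have "poly p x = x ^ ?r * poly q x" by (subst q(1)) (simp add: poly_power)
    moreover have "\<bar>x\<bar> ^ (n + 1) = \<bar>x\<bar> ^ ?r * \<bar>x\<bar> ^ (n + 1 - ?r)"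
      using ord by (simp flip: power_add)
    ultimately have "\<bar>x\<bar> ^ ?r * \<bar>poly q x\<bar> \<le> \<bar>x\<bar> ^ ?r * (c * \<bar>x\<bar> ^ (n + 1 - ?r))"
      using elim(1) by (simp add: abs_mult power_abs mult.left_commute del: power_Suc)
    then show ?case using elim(2) by simp
  qed
  have lim1: "((\<lambda>x. \<bar>poly q x\<bar>) \<longlongrightarrow> \<bar>poly q 0\<bar>) (at 0)" by (intro tendsto_intros)
  have "((\<lambda>x::real. c * \<bar>x\<bar> ^ (n + 1 - order 0 p)) \<longlongrightarrow> c * \<bar>0\<bar> ^ (n + 1 - order 0 p)) (at 0)"
    by (intro tendsto_intros)
  then have lim2: "((\<lambda>x::real. c * \<bar>x\<bar> ^ (n + 1 - order 0 p)) \<longlongrightarrow> 0) (at 0)"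
    using ord by (simp add: power_0_left)
  have "\<bar>poly q 0\<bar> \<le> 0" by (rule tendsto_le[OF _ lim2 lim1 ev]) simp
  then show False using q0 by simp
qed

lemma eventually_poly_neq_0:
  fixes q :: "real poly"
  assumes "poly q 0 \<noteq> 0"
  shows "\<forall>\<^sub>F x in at 0. poly q x \<noteq> 0"
  by (rule tendsto_imp_eventually_ne[OF _ assms]) (intro tendsto_intros)

text \<open>The cross difference \<open>p q' - p' q\<close> is \<open>O(x^(k+m+1))\<close> at 0 but has degree at most \<open>k + m\<close>, so it is 0; lowest
terms and the normalisation of the denominators do the rest.\<close>

lemma is_pade_unique:
  assumes 1: "is_pade f k m p q" and 2: "is_pade f k m p' q'"
  shows "p = p' \<and> q = q'"
proof -
  let ?d = "p * q' - p' * q"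
  have q0: "poly q 0 = 1" "poly q' 0 = 1" and cop: "coprime q p" "coprime q' p'"
    using 1 2 by (auto simp: is_pade_def coprime_commute)
  have nz: "\<forall>\<^sub>F x in at 0. poly q x \<noteq> 0" and nz': "\<forall>\<^sub>F x in at 0. poly q' x \<noteq> 0"
    using q0 by (auto intro: eventually_poly_neq_0)
  have "(\<lambda>x. (f x - poly p' x / poly q' x) - (f x - poly p x / poly q x)) \<in> O[at 0](\<lambda>x. x ^ (k + m + 1))"
    using 1 2 unfolding is_pade_def by (intro sum_in_bigo(2)[where f = "\<lambda>x. f x - poly p' x / poly q' x"]) blast+
  moreover have "poly (q * q') \<in> O[at 0](\<lambda>_. 1)"
    by (rule bigoI_tendsto[where c = "poly (q * q') 0"]) (auto intro!: tendsto_eq_intros)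
  ultimately have big: "(\<lambda>x. ((f x - poly p' x / poly q' x) - (f x - poly p x / poly q x)) * poly (q * q') x)
      \<in> O[at 0](\<lambda>x. x ^ (k + m + 1) * 1)"
    by (rule landau_o.big.mult)
  have cong: "\<forall>\<^sub>F x in at 0. ((f x - poly p' x / poly q' x) - (f x - poly p x / poly q x)) * poly (q * q') x = poly ?d x"
    using nz nz' by eventually_elim (simp add: field_simps)
  have "poly ?d \<in> O[at 0](\<lambda>x. x ^ (k + m + 1))"
    using big unfolding mult_1_right landau_o.big.in_cong[OF cong] .
  moreover have "degree ?d \<le> k + m"
    using 1 2 unfolding is_pade_def
    by (intro degree_diff_le order.trans[OF degree_mult_le] add_mono) auto
  ultimately have "?d = 0" by (rule poly_bigo_eq_0)
  then have eq: "p * q' = p' * q" by simp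
  have "q dvd p * q'" "q' dvd p' * q" using eq dvd_triv_right[of q p'] dvd_triv_right[of q' p] by auto
  then have dvd: "q dvd q'" "q' dvd q"
    using cop by (simp_all add: coprime_dvd_mult_right_iff)
  have "q \<noteq> 0" "q' \<noteq> 0" using q0 by auto
  obtain r where r: "q' = q * r" using dvd(1) by (elim dvdE)
  have "degree q' \<le> degree q" using dvd(2) \<open>q \<noteq> 0\<close> by (rule dvd_imp_degree_le)
  then have "degree r = 0" using r \<open>q \<noteq> 0\<close> \<open>q' \<noteq> 0\<close> by (auto simp: degree_mult_eq)
  then obtain c where "r = [:c:]" by (rule degree_eq_zeroE)
  then have "q = q'" using q0 r by auto
  then show ?thesis using eq \<open>q \<noteq> 0\<close> by simp
qed

lemma pade_eq:
  assumes "is_pade f k m p q"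
  shows "pade f k m x = poly p x / poly q x"
proof -
  have "(THE (p, q). is_pade f k m p q) = (p, q)"
  proof (rule the_equality)
    show "case (p, q) of (p, q) \<Rightarrow> is_pade f k m p q" using assms by simp
    show "z = (p, q)" if "case z of (p, q) \<Rightarrow> is_pade f k m p q" for z
      using that is_pade_unique[OF assms, of "fst z" "snd z"] by (cases z) auto
  qed
  then show ?thesis by (simp add: pade_def)
qed

text \<open>Cancelling the greatest common divisor and rescaling turns \<open>P\<close> and \<open>Q\<close> into the Pade pair and changes
the quotient at most at the zeros of \<open>Q\<close>.\<close>

lemma pade_eq_unreduced:
  fixes P Q :: "real poly"
  assumes deg: "degree P \<le> k" "degree Q \<le> m" and Q0: "poly Q 0 = 1"
    and O: "(\<lambda>x. f x - poly P x / poly Q x) \<in> O[at 0](\<lambda>x. x ^ (k + m + 1))"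
    and Qx: "poly Q x \<noteq> 0"
  shows "pade f k m x = poly P x / poly Q x"
proof -
  have "Q \<noteq> 0" using Q0 by auto
  define g where "g = gcd P Q"
  have "g \<noteq> 0" using \<open>Q \<noteq> 0\<close> by (simp add: g_def)
  obtain p q where pq: "P = p * g" "Q = q * g" "coprime p q"
    using gcd_coprime_exists[of P Q] \<open>Q \<noteq> 0\<close> unfolding g_def by auto
  define c where "c = poly q 0"
  have "c \<noteq> 0" using Q0 unfolding pq c_def by auto
  define p1 where "p1 = smult (1 / c) p"
  define q1 where "q1 = smult (1 / c) q"
  have quot: "poly p1 y / poly q1 y = poly P y / poly Q y" if "poly Q y \<noteq> 0" for y
    using that \<open>c \<noteq> 0\<close> unfolding pq p1_def q1_def by auto
  have "is_pade f k m p1 q1"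
    unfolding is_pade_def
  proof (intro conjI)
    show "degree p1 \<le> k"
    proof (cases "p = 0")
      case False
      then show ?thesis using deg(1) \<open>g \<noteq> 0\<close> \<open>c \<noteq> 0\<close> unfolding pq p1_def by (simp add: degree_mult_eq)
    qed (simp add: p1_def)
    have "q \<noteq> 0" using \<open>Q \<noteq> 0\<close> pq(2) by auto
    then show "degree q1 \<le> m"
      using deg(2) \<open>g \<noteq> 0\<close> \<open>c \<noteq> 0\<close> unfolding pq q1_def by (simp add: degree_mult_eq)
    show "poly q1 0 = 1" using \<open>c \<noteq> 0\<close> by (simp add: q1_def c_def)
    show "coprime p1 q1"
      using pq(3) \<open>c \<noteq> 0\<close> unfolding p1_def q1_def coprime_def by (simp add: dvd_smult_iff)
    have "\<forall>\<^sub>F y in at 0. f y - poly P y / poly Q y = f y - poly p1 y / poly q1 y"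
      using eventually_poly_neq_0[of Q] Q0 by (auto elim!: eventually_mono simp: quot)
    from landau_o.big.in_cong[OF this] O
    show "(\<lambda>x. f x - poly p1 x / poly q1 x) \<in> O[at 0](\<lambda>x. x ^ (k + m + 1))" by simp
  qed
  from pade_eq[OF this] quot[OF Qx] show ?thesis by simp
qed

text \<open>The error of the quadrature on \<open>[0, 1]\<close> for the monomial \<open>u^k\<close>.\<close>

definition quadrature_defect :: "('m::finite \<Rightarrow> real) \<Rightarrow> ('m \<Rightarrow> real) \<Rightarrow> nat \<Rightarrow> real" where
  "quadrature_defect \<tau> \<omega> k = 1 / real (Suc k) - (\<Sum>j\<in>UNIV. \<omega> j * \<tau> j ^ k)"

lemma ln_one_plus_sums:
  assumes "\<bar>x::real\<bar> < 1"
  shows "(\<lambda>k. (- 1) ^ k / real (Suc k) * x ^ Suc k) sums ln (1 + x)"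
proof -
  have "(\<lambda>k. - ((- x) ^ Suc k) / real (Suc k)) sums ln (1 + x)"
    using ln_series'[OF assms] sums_Suc_iff[of "\<lambda>n. - ((- x) ^ n) / real n" "ln (1 + x)"] by simp
  moreover have "- ((- x) ^ Suc k) / real (Suc k) = (- 1) ^ k / real (Suc k) * x ^ Suc k" for k
    by (cases "even k") auto
  ultimately show ?thesis by (simp only:)
qed

text \<open>Expand \<open>1 / (1 + \<tau> j x)\<close> as a geometric series and compare with the series of the logarithm.\<close>

lemma log_minus_quadrature_sums:
  fixes \<tau> \<omega> :: "'m::finite \<Rightarrow> real"
  assumes \<tau>: "\<And>j. \<bar>\<tau> j\<bar> \<le> 1" and x: "\<bar>x\<bar> < 1"
  shows "(\<lambda>k. (- 1) ^ k * quadrature_defect \<tau> \<omega> k * x ^ Suc k) sums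
           (ln (1 + x) - x * (\<Sum>j\<in>UNIV. \<omega> j / (1 + \<tau> j * x)))"
proof -
  have "(\<lambda>k. \<omega> j * x * (- (\<tau> j * x)) ^ k) sums (\<omega> j * x * (1 / (1 - (- (\<tau> j * x)))))" for j
  proof (intro sums_mult geometric_sums)
    have "\<bar>\<tau> j\<bar> * \<bar>x\<bar> \<le> 1 * \<bar>x\<bar>" using \<tau> by (intro mult_right_mono) auto
    then show "norm (- (\<tau> j * x)) < 1" using x by (simp add: abs_mult)
  qed
  then have "(\<lambda>k. \<Sum>j\<in>UNIV. \<omega> j * x * (- (\<tau> j * x)) ^ k) sums (\<Sum>j\<in>UNIV. \<omega> j * x * (1 / (1 - (- (\<tau> j * x)))))"
    by (rule sums_sum)
  from sums_diff[OF ln_one_plus_sums[OF x] this]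
  have "(\<lambda>k. (- 1) ^ k / real (Suc k) * x ^ Suc k - (\<Sum>j\<in>UNIV. \<omega> j * x * (- (\<tau> j * x)) ^ k)) sums
      (ln (1 + x) - x * (\<Sum>j\<in>UNIV. \<omega> j / (1 + \<tau> j * x)))"
    by (simp add: sum_distrib_left mult.commute)
  moreover have "(- 1) ^ k / real (Suc k) * x ^ Suc k - (\<Sum>j\<in>UNIV. \<omega> j * x * (- (\<tau> j * x)) ^ k) =
      (- 1) ^ k * quadrature_defect \<tau> \<omega> k * x ^ Suc k" for k
  proof -
    have "(\<Sum>j\<in>UNIV. \<omega> j * x * (- (\<tau> j * x)) ^ k) = (- 1) ^ k * (\<Sum>j\<in>UNIV. \<omega> j * \<tau> j ^ k) * x ^ Suc k"
      unfolding sum_distrib_left sum_distrib_right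
      by (intro sum.cong refl) (cases "even k", auto simp: power_mult_distrib mult_ac)
    then show ?thesis by (simp add: quadrature_defect_def algebra_simps)
  qed
  ultimately show ?thesis by simp
qed

lemma quadrature_rational:
  fixes \<tau> \<omega> :: "'m::finite \<Rightarrow> real"
  obtains P Q :: "real poly" where "degree P \<le> CARD('m)" "degree Q \<le> CARD('m)"
    "\<And>x. poly Q x = (\<Prod>j\<in>UNIV. 1 + \<tau> j * x)"
    "\<And>x. (\<And>j. 1 + \<tau> j * x \<noteq> 0) \<Longrightarrow> poly P x / poly Q x = x * (\<Sum>j\<in>UNIV. \<omega> j / (1 + \<tau> j * x))"
proof -
  define Q where "Q = (\<Prod>j\<in>UNIV. [:1, \<tau> j:])"
  define P where "P = (\<Sum>j\<in>UNIV. [:0, \<omega> j:] * (\<Prod>k\<in>UNIV - {j}. [:1, \<tau> k:]))"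
  have deg: "degree (\<Prod>k\<in>J. [:1, \<tau> k:]) \<le> card J" for J
  proof -
    have "degree (\<Prod>k\<in>J. [:1, \<tau> k:]) \<le> sum (degree \<circ> (\<lambda>k. [:1, \<tau> k:])) J"
      by (rule degree_prod_sum_le) simp
    also have "\<dots> \<le> (\<Sum>k\<in>J. 1)" by (intro sum_mono) simp
    finally show ?thesis by simp
  qed
  have degQ: "degree Q \<le> CARD('m)" unfolding Q_def by (rule deg)
  have degP: "degree P \<le> CARD('m)"
    unfolding P_def
  proof (intro degree_sum_le)
    fix j
    have "degree ([:0, \<omega> j:] * (\<Prod>k\<in>UNIV - {j}. [:1, \<tau> k:])) \<le> 1 + card (UNIV - {j})"
      by (intro order.trans[OF degree_mult_le] add_mono deg) simp
    also have "\<dots> = CARD('m)" by (simp add: card_Diff_singleton card_gt_0_iff Suc_leI)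
    finally show "degree ([:0, \<omega> j:] * (\<Prod>k\<in>UNIV - {j}. [:1, \<tau> k:])) \<le> CARD('m)" .
  qed simp
  have Q: "poly Q x = (\<Prod>j\<in>UNIV. 1 + \<tau> j * x)" for x
    by (simp add: Q_def poly_prod mult.commute)
  have quot: "poly P x / poly Q x = x * (\<Sum>j\<in>UNIV. \<omega> j / (1 + \<tau> j * x))" if nz: "\<And>j. 1 + \<tau> j * x \<noteq> 0" for x
  proof -
    have Qj: "poly Q x = (1 + \<tau> j * x) * (\<Prod>k\<in>UNIV - {j}. 1 + \<tau> k * x)" for j
      unfolding Q by (rule prod.remove) auto
    have "poly P x = (\<Sum>j\<in>UNIV. x * \<omega> j * (\<Prod>k\<in>UNIV - {j}. 1 + \<tau> k * x))"
      by (simp add: P_def poly_sum poly_prod mult_ac)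
    then have "poly P x / poly Q x = (\<Sum>j\<in>UNIV. x * \<omega> j * (\<Prod>k\<in>UNIV - {j}. 1 + \<tau> k * x) / poly Q x)"
      by (simp add: sum_divide_distrib)
    also have "\<dots> = (\<Sum>j\<in>UNIV. x * (\<omega> j / (1 + \<tau> j * x)))"
    proof (intro sum.cong refl)
      fix j
      have "(\<Prod>k\<in>UNIV - {j}. 1 + \<tau> k * x) \<noteq> 0" using nz by simp
      then show "x * \<omega> j * (\<Prod>k\<in>UNIV - {j}. 1 + \<tau> k * x) / poly Q x = x * (\<omega> j / (1 + \<tau> j * x))"
        unfolding Qj[of j] by simp
    qed
    finally show ?thesis by (simp add: sum_distrib_left)
  qed
  show thesis by (rule that[OF degP degQ Q quot])
qed

context
  fixes t s :: "'m::finite \<Rightarrow> real"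
  assumes gauss: "gauss_legendre t s"
begin

abbreviation "defect \<equiv> quadrature_defect (unit_nodes t) (unit_weights s)"

lemma defect_nonneg: "defect k \<ge> 0"
  using unit_moment_le[OF gauss, of k] by (simp add: quadrature_defect_def)

lemma defect_eq_0: "k < 2 * CARD('m) \<Longrightarrow> defect k = 0"
  using unit_moment_exact[OF gauss, of k] by (simp add: quadrature_defect_def)

lemma defect_sums:
  assumes "\<bar>x\<bar> < 1"
  shows "(\<lambda>k. (- 1) ^ k * defect k * x ^ Suc k) sums
     (ln (1 + x) - x * (\<Sum>j\<in>UNIV. unit_weights s j / (1 + unit_nodes t j * x)))"
proof (rule log_minus_quadrature_sums[OF _ assms])
  show "\<bar>unit_nodes t j\<bar> \<le> 1" for j using unit_node_bounds[OF gauss, of j] by simp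
qed

lemma one_plus_node_pos:
  assumes "\<bar>x\<bar> < 1"
  shows "1 + unit_nodes t j * x > 0"
proof -
  have "\<bar>unit_nodes t j * x\<bar> \<le> 1 * \<bar>x\<bar>"
    unfolding abs_mult using unit_node_bounds[OF gauss, of j] by (intro mult_right_mono) auto
  then show ?thesis using assms by linarith
qed

lemma quadrature_error_bigo:
  "(\<lambda>x. ln (1 + x) - x * (\<Sum>j\<in>UNIV. unit_weights s j / (1 + unit_nodes t j * x)))
     \<in> O[at 0](\<lambda>x. x ^ (2 * CARD('m) + 1))"
proof -
  let ?e = "\<lambda>x. ln (1 + x) - x * (\<Sum>j\<in>UNIV. unit_weights s j / (1 + unit_nodes t j * x))"
  let ?n = "2 * CARD('m)"
  have tail: "(\<lambda>k. (- 1) ^ (k + ?n) * defect (k + ?n) * x ^ Suc (k + ?n)) sums ?e x" if "\<bar>x\<bar> < 1" for x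
  proof -
    have "(\<Sum>k<?n. (- 1) ^ k * defect k * x ^ Suc k) = 0" by (simp add: defect_eq_0)
    then show ?thesis
      using defect_sums[OF that] sums_split_initial_segment[of "\<lambda>k. (- 1) ^ k * defect k * x ^ Suc k" "?e x" ?n] by simp
  qed
  \<comment> \<open>At \<open>x = -1/2\<close> the error series has terms of one sign, so it converges absolutely and dominates the
      tail for \<open>\<bar>x\<bar> < 1/2\<close>.\<close>
  have "summable (\<lambda>k. (- 1) ^ (k + ?n) * defect (k + ?n) * (- (1/2)) ^ Suc (k + ?n))"
    using tail[of "- (1/2)"] by (simp add: sums_iff)
  moreover have "(- 1) ^ (k + ?n) * defect (k + ?n) * (- (1/2)) ^ Suc (k + ?n) =
      - ((1/2) ^ Suc ?n) * (defect (k + ?n) * (1/2) ^ k)" for k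
    by (cases "even k") (auto simp: power_add)
  ultimately have "summable (\<lambda>k. - ((1/2) ^ Suc ?n) * (defect (k + ?n) * (1/2) ^ k))"
    by (simp only:)
  then have summ: "summable (\<lambda>k. defect (k + ?n) * (1/2) ^ k)"
    by (rule summable_mult_D) simp
  let ?C = "\<Sum>k. defect (k + ?n) * (1/2) ^ k"
  have bound: "\<bar>?e x\<bar> \<le> ?C * \<bar>x ^ (?n + 1)\<bar>" if x: "\<bar>x\<bar> < 1/2" for x
  proof -
    have le: "norm ((- 1) ^ (k + ?n) * defect (k + ?n) * x ^ Suc (k + ?n)) \<le> \<bar>x ^ (?n + 1)\<bar> * (defect (k + ?n) * (1/2) ^ k)" for k
    proof -
      have "norm ((- 1) ^ (k + ?n) * defect (k + ?n) * x ^ Suc (k + ?n)) = \<bar>x\<bar> ^ (?n + 1) * (defect (k + ?n) * \<bar>x\<bar> ^ k)"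
        using defect_nonneg[of "k + ?n"] by (simp add: abs_mult power_abs power_add mult_ac)
      also have "\<dots> \<le> \<bar>x\<bar> ^ (?n + 1) * (defect (k + ?n) * (1/2) ^ k)"
        using x by (intro mult_left_mono power_mono defect_nonneg) auto
      finally show ?thesis by (simp add: power_abs abs_mult)
    qed
    have sx: "?e x = (\<Sum>k. (- 1) ^ (k + ?n) * defect (k + ?n) * x ^ Suc (k + ?n))"
      by (rule sums_unique[OF tail]) (use x in simp)
    have "\<bar>?e x\<bar> \<le> (\<Sum>k. \<bar>x ^ (?n + 1)\<bar> * (defect (k + ?n) * (1/2) ^ k))"
      unfolding sx real_norm_def[symmetric] by (rule norm_suminf_le[OF le[unfolded real_norm_def[symmetric]] summable_mult[OF summ]])
    also have "\<dots> = \<bar>x ^ (?n + 1)\<bar> * ?C" by (rule suminf_mult[OF summ])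
    finally show ?thesis by (simp add: mult.commute)
  qed
  have "\<forall>\<^sub>F x in at (0::real). \<bar>x\<bar> < 1/2"
    unfolding eventually_at by (intro exI[of _ "1/2"]) auto
  then have "\<forall>\<^sub>F x in at 0. norm (?e x) \<le> ?C * norm (x ^ (?n + 1))"
    by eventually_elim (use bound in simp)
  then show ?thesis by (rule bigoI)
qed

lemma r_log_eq_quadrature:
  assumes x: "\<bar>x\<bar> < 1"
  shows "r_log CARD('m) x = x * (\<Sum>j\<in>UNIV. unit_weights s j / (1 + unit_nodes t j * x))"
proof -
  obtain P Q where PQ: "degree P \<le> CARD('m)" "degree Q \<le> CARD('m)"
    "\<And>x. poly Q x = (\<Prod>j\<in>UNIV. 1 + unit_nodes t j * x)"
    "\<And>x. (\<And>j. 1 + unit_nodes t j * x \<noteq> 0) \<Longrightarrow>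
        poly P x / poly Q x = x * (\<Sum>j\<in>UNIV. unit_weights s j / (1 + unit_nodes t j * x))"
    using quadrature_rational[of "unit_nodes t" "unit_weights s"] by blast
  have nz: "1 + unit_nodes t j * y \<noteq> 0" if "\<bar>y\<bar> < 1" for j y
    using one_plus_node_pos[OF that, of j] by simp
  have quot: "poly P y / poly Q y = y * (\<Sum>j\<in>UNIV. unit_weights s j / (1 + unit_nodes t j * y))" if "\<bar>y\<bar> < 1" for y
    by (rule PQ(4)) (rule nz[OF that])
  have "\<forall>\<^sub>F y in at (0::real). \<bar>y\<bar> < 1"
    unfolding eventually_at by (intro exI[of _ 1]) auto
  then have "\<forall>\<^sub>F y in at 0. ln (1 + y) - y * (\<Sum>j\<in>UNIV. unit_weights s j / (1 + unit_nodes t j * y)) =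
      ln (1 + y) - poly P y / poly Q y"
    by eventually_elim (simp add: quot)
  from landau_o.big.in_cong[OF this] quadrature_error_bigo
  have "(\<lambda>y. ln (1 + y) - poly P y / poly Q y) \<in> O[at 0](\<lambda>y. y ^ (CARD('m) + CARD('m) + 1))"
    by (simp add: mult_2)
  from pade_eq_unreduced[OF PQ(1,2) _ this, of x] nz[OF x] quot[OF x] show ?thesis
    by (simp add: r_log_def PQ(3))
qed

text \<open>At \<open>-\<rho>\<close> the alternating signs of the error series cancel, and all terms are nonnegative.\<close>

lemma defect_sums_pade_error:
  assumes \<rho>: "0 \<le> \<rho>" "\<rho> < 1"
  shows "(\<lambda>k. defect k * \<rho> ^ Suc k) sums \<bar>r_log CARD('m) (- \<rho>) - ln (1 - \<rho>)\<bar>"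
proof -
  have "\<bar>- \<rho>\<bar> < 1" using \<rho> by simp
  from sums_minus[OF defect_sums[OF this], unfolded minus_diff_eq r_log_eq_quadrature[OF this, symmetric]]
  have "(\<lambda>k. - ((- 1) ^ k * defect k * (- \<rho>) ^ Suc k)) sums (r_log CARD('m) (- \<rho>) - ln (1 - \<rho>))"
    by simp
  moreover have "- ((- 1) ^ k * defect k * (- \<rho>) ^ Suc k) = defect k * \<rho> ^ Suc k" for k
    by (cases "even k") auto
  ultimately have s: "(\<lambda>k. defect k * \<rho> ^ Suc k) sums (r_log CARD('m) (- \<rho>) - ln (1 - \<rho>))"
    by (simp only:)
  moreover have "0 \<le> r_log CARD('m) (- \<rho>) - ln (1 - \<rho>)"
    by (rule sums_le[OF _ sums_zero s]) (use defect_nonneg \<rho> in simp)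
  ultimately show ?thesis by simp
qed

end

section \<open>The error of the output state\<close>

text \<open>One half of the bound is the change of direction at the scale of \<open>f\<close>, the other the change of length.\<close>

lemma norm_sgn_diff_le:
  fixes f h :: "'a :: real_normed_vector"
  assumes "f \<noteq> 0"
  shows "norm (sgn f - sgn h) \<le> 2 * norm (f - h) / norm f"
proof (cases "h = 0")
  case True
  then show ?thesis using assms by (simp add: norm_sgn)
next
  case False
  have "sgn f - sgn h = (f - h) /\<^sub>R norm f + (inverse (norm f) - inverse (norm h)) *\<^sub>R h"
    by (simp add: sgn_div_norm algebra_simps)
  then have "norm (sgn f - sgn h) \<le> norm ((f - h) /\<^sub>R norm f) + norm ((inverse (norm f) - inverse (norm h)) *\<^sub>R h)"
    by (simp only: norm_triangle_ineq)
  also have "norm ((f - h) /\<^sub>R norm f) = norm (f - h) / norm f"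
    by (simp add: divide_inverse mult.commute)
  also have "norm ((inverse (norm f) - inverse (norm h)) *\<^sub>R h) = \<bar>(inverse (norm f) - inverse (norm h)) * norm h\<bar>"
    by (simp add: abs_mult)
  also have "(inverse (norm f) - inverse (norm h)) * norm h = (norm h - norm f) / norm f"
    using assms False by (simp add: field_simps)
  also have "\<bar>(norm h - norm f) / norm f\<bar> \<le> norm (f - h) / norm f"
    using norm_triangle_ineq3[of h f] by (simp add: norm_minus_commute divide_right_mono)
  finally show ?thesis by simp
qed

lemma norm_eq_L2_set_blocks: "norm x = L2_set (\<lambda>j. norm (block x j)) UNIV"
proof -
  have "(\<Sum>r\<in>UNIV. (norm (x $ r))\<^sup>2) = (\<Sum>j\<in>UNIV. \<Sum>i\<in>UNIV. (norm (x $ (j, i)))\<^sup>2)"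
    by (simp add: sum.cartesian_product flip: UNIV_Times_UNIV)
  then show ?thesis
    by (simp add: norm_vec_def L2_set_def block_def sum_nonneg)
qed

lemma block_simps:
  "block (x - y) j = block x j - block y j" "block (r *\<^sub>R x) j = r *\<^sub>R block x j"
  by (simp_all add: block_def vec_eq_iff)

lemma block_block_diag_mult: "block (block_diag B *v x) j = B j *v block x j"
proof -
  have "(\<Sum>r\<in>UNIV. (if j = fst r then B j $ i $ snd r else 0) * x $ r) = (\<Sum>l\<in>UNIV. B j $ i $ l * x $ (j, l))" for i
  proof -
    have "(\<Sum>r\<in>UNIV. (if j = fst r then B j $ i $ snd r else 0) * x $ r) =
        (\<Sum>k\<in>UNIV. \<Sum>l\<in>UNIV. (if j = k then B j $ i $ l else 0) * x $ (k, l))"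
      by (simp add: sum.cartesian_product case_prod_unfold flip: UNIV_Times_UNIV)
    also have "\<dots> = (\<Sum>k\<in>UNIV. if j = k then \<Sum>l\<in>UNIV. B j $ i $ l * x $ (k, l) else 0)"
      by (intro sum.cong refl) auto
    finally show ?thesis by simp
  qed
  then show ?thesis
    by (simp add: block_def block_diag_def matrix_vector_mult_def vec_eq_iff cong: if_cong)
qed

lemma block_copies: "block (copies b) j = b"
  by (simp add: block_def copies_def vec_eq_iff)

lemma norm_matrix_vector_le: "norm (X *v v) \<le> opnorm X * norm v"
  using norm_endo_apply[of "endo_of_matrix X" v] by (simp add: norm_endo_of_matrix)

lemma matrix_vector_scaleR: "X *v (r *\<^sub>R v) = r *\<^sub>R (X *v v)" for X :: "complex ^ 'n ^ 'n"
  using endo_apply.scaleR_right[of "endo_of_matrix X" r v] by simp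

lemma opnorm_nonneg: "0 \<le> opnorm X"
  using norm_ge_zero[of "endo_of_matrix X"] by (simp only: norm_endo_of_matrix)

lemma norm_weighted_block_sum_le:
  "norm (\<Sum>j\<in>UNIV. \<omega> j *\<^sub>R block v j) \<le> sqrt (\<Sum>j\<in>UNIV. \<bar>\<omega> j\<bar> ^ 2) * norm v"
proof -
  have "norm (\<Sum>j\<in>UNIV. \<omega> j *\<^sub>R block v j) \<le> (\<Sum>j\<in>UNIV. \<bar>\<omega> j\<bar> * \<bar>norm (block v j)\<bar>)"
    by (rule order.trans[OF norm_sum]) simp
  also have "\<dots> \<le> L2_set \<omega> UNIV * L2_set (\<lambda>j. norm (block v j)) UNIV"
    by (rule L2_set_mult_ineq)
  finally show ?thesis by (simp add: norm_eq_L2_set_blocks L2_set_def)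
qed

lemma shifted_system_solution_bound:
  assumes E: "opnorm E < 1" and \<tau>: "0 \<le> \<tau>" "\<tau> \<le> 1"
    and v: "(\<tau> *\<^sub>R E + mat 1) *v v = b"
  shows "norm v \<le> norm b / (1 - opnorm E)"
proof -
  have b: "b = \<tau> *\<^sub>R (E *v v) + v"
    using v by (simp add: matrix_vector_mult_add_rdistrib matrix_scaleR_vector)
  have "norm (\<tau> *\<^sub>R (E *v v)) \<le> 1 * (opnorm E * norm v)"
    unfolding norm_scaleR using \<tau> norm_matrix_vector_le[of E v] by (intro mult_mono) auto
  moreover have "norm v - norm (\<tau> *\<^sub>R (E *v v)) \<le> norm b"
    unfolding b using norm_triangle_ineq2[of v "- (\<tau> *\<^sub>R (E *v v))"] by (simp add: add.commute)
  ultimately have "norm v * (1 - opnorm E) \<le> norm b" by (simp add: algebra_simps)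
  then show ?thesis using E by (simp add: pos_le_divide_eq)
qed

text \<open>Both sides are power series in \<open>E = A - I\<close> applied to \<open>b\<close>, since \<open>v j\<close> is the Neumann series of
\<open>(I + \<tau> j E)\<^sup>-\<^sup>1\<close> at \<open>b\<close>.  The coefficients of their difference are the quadrature defects up to sign, so the
triangle inequality yields the scalar error at \<open>-\<rho>\<close>.\<close>

lemma log_quadrature_error:
  fixes A :: "complex ^ 'n ^ 'n" and t s :: "'m::finite \<Rightarrow> real"
  assumes A: "opnorm (A - mat 1) < 1" and gauss: "gauss_legendre t s"
    and v: "\<And>j. (unit_nodes t j *\<^sub>R (A - mat 1) + mat 1) *v v j = b"
  shows "norm (principal_log A *v b - (A - mat 1) *v (\<Sum>j\<in>UNIV. unit_weights s j *\<^sub>R v j))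
    \<le> eps_pade CARD('m) A * norm b"
proof -
  define e where "e = endo_of_matrix (A - mat 1)"
  define \<rho> where "\<rho> = opnorm (A - mat 1)"
  let ?\<tau> = "unit_nodes t" and ?\<omega> = "unit_weights s"
  define c where "c k = quadrature_defect ?\<tau> ?\<omega> k" for k
  have \<rho>: "norm e = \<rho>" "0 \<le> \<rho>" "\<rho> < 1"
    using A opnorm_nonneg by (auto simp: e_def \<rho>_def norm_endo_of_matrix)
  have e1: "norm e < 1" using \<rho> by simp
  define G where "G j = (\<Sum>k. (- 1) ^ k *\<^sub>R (?\<tau> j *\<^sub>R e) ^ k)" for j
  have te: "norm (?\<tau> j *\<^sub>R e) < 1" for j
    using unit_node_bounds[OF gauss, of j] \<rho> mult_mono[of "?\<tau> j" 1 \<rho> \<rho>] by simp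
  have sum_G: "(\<lambda>k. (- 1) ^ k *\<^sub>R (?\<tau> j *\<^sub>R e) ^ k) sums G j" for j
    unfolding G_def by (intro summable_sums summable_bounded_power_series te) simp
  have v_eq: "v j = endo_apply (G j) b" for j
  proof -
    have "b = endo_apply (1 + ?\<tau> j *\<^sub>R e) (v j)"
      using v[of j] by (simp add: e_def endo_apply.add_left endo_apply.scaleR_left
        matrix_vector_mult_add_rdistrib matrix_scaleR_vector add.commute)
    then have "endo_apply (G j) b = endo_apply (G j * (1 + ?\<tau> j *\<^sub>R e)) (v j)" by simp
    also have "G j * (1 + ?\<tau> j *\<^sub>R e) = 1" unfolding G_def by (rule geometric_series_inverse[OF te])
    finally show ?thesis by simp
  qed
  let ?R = "e * (\<Sum>j\<in>UNIV. ?\<omega> j *\<^sub>R G j)"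
  have "(\<lambda>k. e * (\<Sum>j\<in>UNIV. ?\<omega> j *\<^sub>R ((- 1) ^ k *\<^sub>R (?\<tau> j *\<^sub>R e) ^ k))) sums ?R"
    by (intro sums_mult sums_sum sums_scaleR_right sum_G)
  moreover have "e * (\<Sum>j\<in>UNIV. ?\<omega> j *\<^sub>R ((- 1) ^ k *\<^sub>R (?\<tau> j *\<^sub>R e) ^ k)) =
      ((- 1) ^ k * (\<Sum>j\<in>UNIV. ?\<omega> j * ?\<tau> j ^ k)) *\<^sub>R e ^ Suc k" for k
    by (simp add: sum_distrib_left scaleR_sum_left mult_ac)
  ultimately have "(\<lambda>k. ((- 1) ^ k * (\<Sum>j\<in>UNIV. ?\<omega> j * ?\<tau> j ^ k)) *\<^sub>R e ^ Suc k) sums ?R"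
    by (simp only:)
  moreover have "(\<lambda>k. ((- 1) ^ k / real (Suc k)) *\<^sub>R e ^ Suc k) sums log_series e"
    unfolding log_series_def
    by (intro summable_sums summable_bounded_power_series e1) (simp add: power_abs)
  ultimately have "(\<lambda>k. ((- 1) ^ k / real (Suc k)) *\<^sub>R e ^ Suc k -
      ((- 1) ^ k * (\<Sum>j\<in>UNIV. ?\<omega> j * ?\<tau> j ^ k)) *\<^sub>R e ^ Suc k) sums (log_series e - ?R)"
    by (rule sums_diff[rotated])
  then have D: "(\<lambda>k. ((- 1) ^ k * c k) *\<^sub>R e ^ Suc k) sums (log_series e - ?R)"
    by (simp add: c_def quadrature_defect_def right_diff_distrib flip: scaleR_diff_left)
  have eps: "(\<lambda>k. c k * \<rho> ^ Suc k) sums eps_pade CARD('m) A"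
    using defect_sums_pade_error[OF gauss \<rho>(2,3)] by (simp only: c_def eps_pade_def \<rho>_def)
  have "norm (log_series e - ?R) \<le> eps_pade CARD('m) A"
    unfolding sums_unique[OF D] sums_unique[OF eps]
  proof (rule norm_suminf_le[OF _ sums_summable[OF eps]])
    fix k
    have "norm (((- 1) ^ k * c k) *\<^sub>R e ^ Suc k) = c k * norm (e ^ Suc k)"
      using defect_nonneg[OF gauss, of k] by (simp add: c_def abs_mult power_abs)
    also have "\<dots> \<le> c k * \<rho> ^ Suc k"
      using defect_nonneg[OF gauss, of k] norm_power_ineq[of e "Suc k"] \<rho>(1)
      by (intro mult_left_mono) (auto simp: c_def)
    finally show "norm (((- 1) ^ k * c k) *\<^sub>R e ^ Suc k) \<le> c k * \<rho> ^ Suc k" .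
  qed
  then have "norm (endo_apply (log_series e - ?R) b) \<le> eps_pade CARD('m) A * norm b"
    by (intro order.trans[OF norm_endo_apply] mult_right_mono) auto
  moreover have "endo_apply (log_series e) b = principal_log A *v b"
    unfolding e_def endo_of_principal_log[OF A, symmetric] by simp
  moreover have "endo_apply ?R b = (A - mat 1) *v (\<Sum>j\<in>UNIV. ?\<omega> j *\<^sub>R v j)"
    by (simp add: e_def v_eq endo_apply.sum_left endo_apply.scaleR_left)
  ultimately show ?thesis by (simp add: endo_apply.diff_left)
qed

theorem theorem4:
  fixes A :: "complex ^ 'n ^ 'n" and b :: "complex ^ 'n"
    and t s \<tau> \<omega> :: "'m::finite \<Rightarrow> real"
    and x y :: "complex ^ ('m \<times> 'n)"
    and \<epsilon> :: real
  assumes "opnorm (A - mat 1) < 1"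
    and "principal_log A *v b \<noteq> 0"
    and "gauss_legendre t s"
    and "\<tau> = unit_nodes t" and "\<omega> = unit_weights s"
    and "system_matrix \<tau> A *v x = copies b"
    and "y \<noteq> 0"
    and "norm (ket x - ket y) \<le> \<epsilon>"
    and "0 < \<epsilon>" and "\<epsilon> < 1 / 2"
    and "output_vector \<omega> A y \<noteq> 0"
  shows "norm (ket (target_vector A b x) - ket (output_vector \<omega> A y))
    \<le> 2 / K_const A b *
      (eps_pade CARD('m) A + sqrt (real CARD('m)) * delta_const \<omega> A * \<epsilon>)"
proof -
  define E where "E = A - mat 1"
  define \<rho> where "\<rho> = opnorm E"
  let ?eps = "eps_pade CARD('m) A" and ?M = "sqrt (real CARD('m))" and ?\<delta> = "delta_const \<omega> A"
  let ?Lb = "principal_log A *v b"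
  have \<rho>: "0 \<le> \<rho>" "\<rho> < 1" using assms(1) opnorm_nonneg by (auto simp: \<rho>_def E_def)
  have xj: "(\<tau> j *\<^sub>R E + mat 1) *v block x j = b" for j
    using arg_cong[OF assms(6), of "\<lambda>w. block w j"]
    by (simp add: system_matrix_def block_block_diag_mult block_copies E_def)
  have "b \<noteq> 0" using assms(2) by auto
  have "x \<noteq> 0"
  proof
    assume "x = 0"
    then have "block x j = 0" for j by (simp add: block_def vec_eq_iff)
    then show False using xj \<open>b \<noteq> 0\<close> by simp
  qed
  have x_bound: "norm x \<le> ?M * (norm b / (1 - \<rho>))"
  proof -
    have "norm (block x j) \<le> norm b / (1 - \<rho>)" for j
      unfolding \<rho>_def
    proof (rule shifted_system_solution_bound[OF _ _ _ xj])
      show "opnorm E < 1" "0 \<le> \<tau> j" "\<tau> j \<le> 1"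
        using \<rho>(2) unit_node_bounds[OF assms(3), of j] by (auto simp: \<rho>_def assms(4))
    qed
    then have "norm x \<le> L2_set (\<lambda>_::'m. norm b / (1 - \<rho>)) UNIV"
      unfolding norm_eq_L2_set_blocks by (intro L2_set_mono) auto
    also have "\<dots> = ?M * (norm b / (1 - \<rho>))"
      using \<rho> by (simp add: L2_set_def real_sqrt_mult)
    finally show ?thesis .
  qed
  \<comment> \<open>\<open>g\<close> is what the algorithm would produce from the exact solution.\<close>
  define f where "f = target_vector A b x"
  define g where "g = (1 / norm x) *\<^sub>R (E *v (\<Sum>j\<in>UNIV. \<omega> j *\<^sub>R block x j))"
  define h where "h = output_vector \<omega> A y"
  have norm_f: "norm f = norm ?Lb / norm x" by (simp add: f_def target_vector_def)
  then have "f \<noteq> 0" using assms(2) \<open>x \<noteq> 0\<close> by auto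
  have fg: "norm (f - g) \<le> ?eps * norm b / norm x"
  proof -
    have "f - g = (1 / norm x) *\<^sub>R (?Lb - E *v (\<Sum>j\<in>UNIV. \<omega> j *\<^sub>R block x j))"
      by (simp add: f_def g_def target_vector_def scaleR_diff_right)
    moreover have "norm (?Lb - E *v (\<Sum>j\<in>UNIV. \<omega> j *\<^sub>R block x j)) \<le> ?eps * norm b"
      using log_quadrature_error[OF assms(1,3), of "block x" b] xj by (simp add: assms(4,5) E_def)
    ultimately show ?thesis by (simp add: divide_right_mono)
  qed
  have gh: "norm (g - h) \<le> ?\<delta> * \<epsilon>"
  proof -
    have split: "(\<Sum>j\<in>UNIV. \<omega> j *\<^sub>R block (ket x - ket y) j) =
        (1 / norm x) *\<^sub>R (\<Sum>j\<in>UNIV. \<omega> j *\<^sub>R block x j) - (1 / norm y) *\<^sub>R (\<Sum>j\<in>UNIV. \<omega> j *\<^sub>R block y j)"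
      by (simp add: block_simps sgn_div_norm scaleR_diff_right sum_subtractf scaleR_sum_right
          divide_inverse mult.commute)
    have "g - h = E *v (\<Sum>j\<in>UNIV. \<omega> j *\<^sub>R block (ket x - ket y) j)"
      unfolding split
      by (simp add: g_def h_def output_vector_def E_def matrix_vector_mult_diff_distrib matrix_vector_scaleR)
    also have "norm \<dots> \<le> \<rho> * (sqrt (\<Sum>j\<in>UNIV. \<bar>\<omega> j\<bar> ^ 2) * norm (ket x - ket y))"
      unfolding \<rho>_def using opnorm_nonneg
      by (intro order.trans[OF norm_matrix_vector_le] mult_left_mono norm_weighted_block_sum_le)
    also have "\<dots> \<le> \<rho> * (sqrt (\<Sum>j\<in>UNIV. \<bar>\<omega> j\<bar> ^ 2) * \<epsilon>)"
      using assms(8) \<rho> by (intro mult_left_mono) (auto intro: sum_nonneg)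
    finally show ?thesis by (simp add: delta_const_def \<rho>_def E_def mult.assoc)
  qed
  have eps0: "0 \<le> ?eps" by (simp add: eps_pade_def)
  have \<delta>0: "0 \<le> ?\<delta> * \<epsilon>" using order.trans[OF norm_ge_zero gh] .
  have "norm (ket f - ket h) \<le> 2 * norm (f - h) / norm f"
    by (rule norm_sgn_diff_le[OF \<open>f \<noteq> 0\<close>])
  also have "\<dots> \<le> 2 * (?eps * norm b / norm x + ?\<delta> * \<epsilon>) / norm f"
    using norm_triangle_ineq[of "f - g" "g - h"] fg gh by (intro divide_right_mono mult_left_mono) auto
  also have "\<dots> = 2 / norm ?Lb * (?eps * norm b + norm x * (?\<delta> * \<epsilon>))"
    using \<open>x \<noteq> 0\<close> unfolding norm_f by (simp add: field_simps)
  also have "\<dots> \<le> 2 / norm ?Lb * (norm b / (1 - \<rho>) * (?eps + ?M * (?\<delta> * \<epsilon>)))"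
  proof (intro mult_left_mono)
    have "norm b * 1 \<le> norm b * (1 / (1 - \<rho>))"
      using \<rho> by (intro mult_left_mono) (auto simp: field_simps)
    then have "?eps * norm b \<le> ?eps * (norm b / (1 - \<rho>))" using eps0 by (intro mult_left_mono) auto
    moreover have "norm x * (?\<delta> * \<epsilon>) \<le> ?M * (norm b / (1 - \<rho>)) * (?\<delta> * \<epsilon>)"
      by (rule mult_right_mono[OF x_bound \<delta>0])
    ultimately show "?eps * norm b + norm x * (?\<delta> * \<epsilon>) \<le> norm b / (1 - \<rho>) * (?eps + ?M * (?\<delta> * \<epsilon>))"
      by (simp add: algebra_simps)
  qed simp
  also have "\<dots> = 2 / K_const A b * (?eps + ?M * ?\<delta> * \<epsilon>)"
  proof -
    have "K_const A b = norm ?Lb / norm b * (1 - \<rho>)"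
      by (simp add: K_const_def \<rho>_def E_def sgn_div_norm matrix_vector_scaleR divide_inverse mult_ac)
    then have "2 / K_const A b = 2 / norm ?Lb * (norm b / (1 - \<rho>))" by simp
    then show ?thesis by (simp only: mult.assoc)
  qed
  finally show ?thesis unfolding f_def h_def .
qed

end
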